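(* Let $\omega(n)$ denote the number of representations of a nonnegative integer $n$ in the form $x_1^2+x_2^2+x_3^2+3y_1^2+3y_2^2+3y_3^2$ with $x_1,x_2,x_3,y_1,y_2,y_3\in\mathbb{Z}$. Then for every integer $n\ge 0$, $$\omega(6n+5)=4B_3(6n+4).$$
   Context: Representations are counted as ordered tuples: $\omega(n)$ is the number of $(x_1,x_2,x_3,y_1,y_2,y_3)\in\mathbb{Z}^6$ with $x_1^2+x_2^2+x_3^2+3y_1^2+3y_2^2+3y_3^2=n$. A partition is a 3-core if none of its hook numbers is a multiple of 3 (the empty partition is a 3-core). For an integer $n\ge 0$, $B_3(n)$ denotes the number of partition triples of $n$ with 3-cores, i.e. ordered triples $(\lambda_1,\lambda_2,\lambda_3)$ of (possibly empty) partitions, each a 3-core, such that the sum of all the parts of $\lambda_1,\lambda_2,\lambda_3$ equals $n$; in particular $B_3(0)=1$. Equivalently (a standard fact recalled in the paper), $\sum_{n\ge 0}B_3(n)q^n=\dfrac{f_3^9}{f_1^3}$, where $f_k=\prod_{m=1}^{\infty}(1-q^{km})$. *)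

theory Defs
  imports Main
begin

text \<open>A partition is the list of its parts in weakly decreasing order, all parts positive;
  the empty partition is \<open>[]\<close>.\<close>

definition is_partition :: "nat list \<Rightarrow> bool" where
  "is_partition p \<longleftrightarrow> sorted_wrt (\<ge>) p \<and> 0 \<notin> set p"

text \<open>Cells \<open>(i, j)\<close> of the Young diagram: row \<open>i\<close>, column \<open>j\<close>, both counted from 0.\<close>

definition cells :: "nat list \<Rightarrow> (nat \<times> nat) set" where
  "cells p = {(i, j). i < length p \<and> j < p ! i}"

text \<open>The hook of a cell consists of the cell itself, the cells to its right in the same row
  (arm) and the cells below it in the same column (leg); the hook number is its size.\<close>

definition hook :: "nat list \<Rightarrow> nat \<times> nat \<Rightarrow> (nat \<times> nat) set" where
  "hook p c = {(k, l) \<in> cells p.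
     (k = fst c \<and> l \<ge> snd c) \<or> (l = snd c \<and> k \<ge> fst c)}"

definition hook_number :: "nat list \<Rightarrow> nat \<times> nat \<Rightarrow> nat" where
  "hook_number p c = card (hook p c)"

definition is_core :: "nat \<Rightarrow> nat list \<Rightarrow> bool" where
  "is_core t p \<longleftrightarrow> is_partition p \<and> (\<forall>c\<in>cells p. \<not> t dvd hook_number p c)"

definition B3 :: "nat \<Rightarrow> nat" where
  "B3 n = card {(p1, p2, p3).
     is_core 3 p1 \<and> is_core 3 p2 \<and> is_core 3 p3 \<and>
     sum_list p1 + sum_list p2 + sum_list p3 = n}"

definition omega :: "nat \<Rightarrow> nat" where
  "omega n = card {(x1 :: int, x2 :: int, x3 :: int, y1 :: int, y2 :: int, y3 :: int).
     x1\<^sup>2 + x2\<^sup>2 + x3\<^sup>2 + 3 * y1\<^sup>2 + 3 * y2\<^sup>2 + 3 * y3\<^sup>2 = int n}"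

text \<open>Both counts are cardinalities of finite sets, so \<open>card\<close> never falls back to its
  default value 0 for infinite sets.\<close>

lemma finite_omega_set:
  "finite {(x1 :: int, x2 :: int, x3 :: int, y1 :: int, y2 :: int, y3 :: int).
     x1\<^sup>2 + x2\<^sup>2 + x3\<^sup>2 + 3 * y1\<^sup>2 + 3 * y2\<^sup>2 + 3 * y3\<^sup>2 = int n}" (is "finite ?A")
proof (rule finite_subset)
  let ?I = "{- int n..int n}"
  show "finite (?I \<times> ?I \<times> ?I \<times> ?I \<times> ?I \<times> ?I)" by simp
  have bnd: "x \<in> ?I" if "x\<^sup>2 \<le> int n" for x :: int
  proof -
    have "\<bar>x\<bar> \<le> x\<^sup>2"
    proof (cases "x = 0")
      case False
      then have "\<bar>x\<bar> * 1 \<le> \<bar>x\<bar> * \<bar>x\<bar>" by (intro mult_left_mono) auto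
      then show ?thesis by (simp add: power2_eq_square)
    qed simp
    with that show ?thesis by auto
  qed
  show "?A \<subseteq> ?I \<times> ?I \<times> ?I \<times> ?I \<times> ?I \<times> ?I"
  proof (clarify, intro conjI SigmaI)
    fix x1 x2 x3 y1 y2 y3 :: int
    assume e: "x1\<^sup>2 + x2\<^sup>2 + x3\<^sup>2 + 3 * y1\<^sup>2 + 3 * y2\<^sup>2 + 3 * y3\<^sup>2 = int n"
    note nn = zero_le_power2[of x1] zero_le_power2[of x2] zero_le_power2[of x3]
      zero_le_power2[of y1] zero_le_power2[of y2] zero_le_power2[of y3]
    show "x1 \<in> ?I" using e nn by (intro bnd) linarith
    show "x2 \<in> ?I" using e nn by (intro bnd) linarith
    show "x3 \<in> ?I" using e nn by (intro bnd) linarith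
    show "y1 \<in> ?I" using e nn by (intro bnd) linarith
    show "y2 \<in> ?I" using e nn by (intro bnd) linarith
    show "y3 \<in> ?I" using e nn by (intro bnd) linarith
  qed
qed

lemma finite_B3_set:
  "finite {(p1, p2, p3).
     is_core 3 p1 \<and> is_core 3 p2 \<and> is_core 3 p3 \<and>
     sum_list p1 + sum_list p2 + sum_list p3 = n}" (is "finite ?A")
proof (rule finite_subset)
  let ?L = "{p. set p \<subseteq> {..n} \<and> length p \<le> n}"
  show "finite (?L \<times> ?L \<times> ?L)"
    by (intro finite_cartesian_product finite_lists_length_le) simp_all
  have len: "length p \<le> sum_list p" if "0 \<notin> set p" for p :: "nat list"
    using that by (induction p) auto
  have "p \<in> ?L" if "is_core 3 p" "sum_list p \<le> n" for p
    using that len[of p] member_le_sum_list[of _ p]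
    by (fastforce simp: is_core_def is_partition_def)
  note L = this
  show "?A \<subseteq> ?L \<times> ?L \<times> ?L"
  proof
    fix x
    assume "x \<in> ?A"
    then obtain p1 p2 p3 where x: "x = (p1, p2, p3)"
      and c: "is_core 3 p1" "is_core 3 p2" "is_core 3 p3"
      and e: "sum_list p1 + sum_list p2 + sum_list p3 = n" by blast
    have "p1 \<in> ?L" "p2 \<in> ?L" "p3 \<in> ?L"
      using e by (intro L c; linarith)+
    then show "x \<in> ?L \<times> ?L \<times> ?L" unfolding x by (intro SigmaI)
  qed
qed

end

theory Submission
  imports Defs "HOL-Computational_Algebra.Formal_Laurent_Series"
begin

text \<open>
  Both sides are counts of vectors over the Eisenstein integers \<open>\<int>[w]\<close>, where \<open>w\<close> is a primitive cube
  root of unity and \<open>x + y w\<close> has norm \<open>x\<^sup>2 - x y + y\<^sup>2\<close>. Write \<open>\<theta> = w - w\<^sup>2\<close>, so that \<open>\<theta>\<^sup>2 = -3\<close>, and let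
  \<open>F\<^sub>i\<close> and \<open>G\<^sub>i\<close> be the theta series of the elements congruent to \<open>i\<close> modulo \<open>\<theta>\<close> and congruent to 0
  (for \<open>F\<^sub>i\<close>) or 1 (for \<open>G\<^sub>i\<close>) modulo 2. The exponents of \<open>F\<^sub>0, F\<^sub>1, G\<^sub>0, G\<^sub>1\<close> are 0, 4, 3, 1 modulo 6,
  and multiplication by \<open>w\<close> permutes the three nonzero classes modulo 2, so all of them have the same
  series. Put \<open>m = 6 n + 5\<close>. Both sides are multiples of the coefficient of \<open>q\<^sup>m\<close> in \<open>G\<^sub>0 G\<^sub>1\<^sup>2\<close>.

  Squares: the form \<open>x\<^sup>2 + 3 y\<^sup>2\<close> is the norm on the subring \<open>\<int>[\<theta>]\<close>, the elements congruent to 0 or 1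
  modulo 2. So \<open>omega\<close> is generated by the cube of \<open>F\<^sub>0 + 2 F\<^sub>1 + G\<^sub>0 + 2 G\<^sub>1\<close>, and in degree \<open>m\<close> only
  \<open>12 (G\<^sub>0 F\<^sub>1\<^sup>2 + 2 F\<^sub>0 F\<^sub>1 G\<^sub>1 + G\<^sub>0 G\<^sub>1\<^sup>2)\<close> survives.

  Cores: the beads of a 3-core fill initial segments of two runners of an abacus, so a 3-core is a
  pair \<open>(r, s)\<close> of naturals, and three times its size plus 1 is the norm of a point in a sector of
  angle \<open>2\<pi>/3\<close>. Hence 3-cores correspond to elements congruent to 1 modulo 3, and \<open>B3 (m - 1)\<close>
  counts the vectors of norm \<open>3 m\<close> with three such entries. The discrete Fourier transform on three
  points multiplies norms by 3 and turns them into the vectors of norm \<open>m\<close> whose entries are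
  congruent to 0, 2, 2 modulo \<open>\<theta>\<close>, subject to one more congruence that selects exactly one third.
  So \<open>3 B3 (m - 1)\<close> is the coefficient in \<open>(F\<^sub>0 + 3 G\<^sub>0) (F\<^sub>1 + 3 G\<^sub>1)\<^sup>2\<close>, and in degree \<open>m\<close> only
  \<open>3 (G\<^sub>0 F\<^sub>1\<^sup>2 + 2 F\<^sub>0 F\<^sub>1 G\<^sub>1) + 27 G\<^sub>0 G\<^sub>1\<^sup>2\<close> survives.

  The bridge is the identity \<open>G\<^sub>0 F\<^sub>1\<^sup>2 + 2 F\<^sub>0 F\<^sub>1 G\<^sub>1 = 3 G\<^sub>0 G\<^sub>1\<^sup>2\<close> (\<open>cubic_relation\<close>), which makes the two
  expressions \<open>48 G\<^sub>0 G\<^sub>1\<^sup>2\<close> and \<open>36 G\<^sub>0 G\<^sub>1\<^sup>2\<close>. Passing from two elements congruent modulo 2 to half their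
  sum and half their difference expresses products of two of the series in \<open>q\<close> as quadratic
  polynomials in the series in \<open>q\<^sup>2\<close> (\<open>product_formulas\<close>). Consequently the difference \<open>D\<close> of the two sides
  satisfies \<open>G\<^sub>1(q) D(q) = 2 (F\<^sub>1 - G\<^sub>1)(q\<^sup>2) D(q\<^sup>2)\<close>. If \<open>D\<close> had lowest degree \<open>d\<close>, the left side would
  have lowest degree \<open>d + 1\<close>, but the right side has lowest degree at least \<open>2 (d + 1)\<close>; so \<open>D = 0\<close>.
\<close>

section \<open>Generating functions of weighted sets\<close>

definition finite_levels :: "('a \<Rightarrow> nat) \<Rightarrow> 'a set \<Rightarrow> bool" where
  "finite_levels w S \<longleftrightarrow> (\<forall>n. finite {z \<in> S. w z = n})"

text \<open>Meaningful for weights with finite levels only, as the cardinality of an infinite set is 0.\<close>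

definition gf :: "('a \<Rightarrow> nat) \<Rightarrow> 'a set \<Rightarrow> int fps" where
  "gf w S = Abs_fps (\<lambda>n. int (card {z \<in> S. w z = n}))"

abbreviation add_weights :: "('a \<Rightarrow> nat) \<Rightarrow> ('b \<Rightarrow> nat) \<Rightarrow> 'a \<times> 'b \<Rightarrow> nat"  (infixr "\<oplus>w" 65) where
  "w \<oplus>w v \<equiv> \<lambda>p. w (fst p) + v (snd p)"

lemma gf_nth: "fps_nth (gf w S) n = int (card {z \<in> S. w z = n})"
  by (simp add: gf_def)

lemma finite_levelsD: "finite_levels w S \<Longrightarrow> finite {z \<in> S. w z = n}"
  by (simp add: finite_levels_def)

lemma finite_levels_subset: "finite_levels w T \<Longrightarrow> S \<subseteq> T \<Longrightarrow> finite_levels w S"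
  unfolding finite_levels_def by (auto intro: finite_subset[where B = "{z \<in> T. w z = _}"])

lemma level_product:
  "{p \<in> S \<times> T. (w \<oplus>w v) p = n} =
    (\<Union>i\<in>{0..n}. {z \<in> S. w z = i} \<times> {z \<in> T. v z = n - i})"
  by force

lemma finite_levels_product:
  assumes "finite_levels w S" "finite_levels v T"
  shows "finite_levels (w \<oplus>w v) (S \<times> T)"
  unfolding finite_levels_def level_product
  using assms by (auto simp: finite_levels_def)

lemma gf_product:
  assumes "finite_levels w S" "finite_levels v T"
  shows "gf (w \<oplus>w v) (S \<times> T) = gf w S * gf v T"
proof (rule fps_ext)
  fix n
  have "card (\<Union>i\<in>{0..n}. {z \<in> S. w z = i} \<times> {z \<in> T. v z = n - i}) =
      (\<Sum>i=0..n. card ({z \<in> S. w z = i} \<times> {z \<in> T. v z = n - i}))"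
    using assms by (intro card_UN_disjoint) (auto simp: finite_levels_def)
  then show "fps_nth (gf (w \<oplus>w v) (S \<times> T)) n = fps_nth (gf w S * gf v T) n"
    by (simp only: gf_nth level_product fps_mult_nth) (simp add: card_cartesian_product)
qed

lemma gf_product3:
  assumes "finite_levels w S" "finite_levels v T" "finite_levels u U"
  shows "gf (w \<oplus>w v \<oplus>w u) (S \<times> T \<times> U) = gf w S * gf v T * gf u U"
  using gf_product[OF assms(1) finite_levels_product[OF assms(2,3)]]
  by (simp add: gf_product[OF assms(2,3)] mult.assoc)

lemma gf_bij:
  assumes "bij_betw f S T" "\<And>z. z \<in> S \<Longrightarrow> v (f z) = w z"
  shows "gf w S = gf v T"
proof (rule fps_ext)
  fix n
  have "bij_betw f {z \<in> S. w z = n} {z \<in> T. v z = n}"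
    using assms unfolding bij_betw_def inj_on_def by force
  then show "fps_nth (gf w S) n = fps_nth (gf v T) n"
    by (simp add: gf_nth bij_betw_same_card)
qed

lemma finite_levels_bij:
  assumes "bij_betw f S T" "\<And>z. z \<in> S \<Longrightarrow> v (f z) = w z" "finite_levels v T"
  shows "finite_levels w S"
  unfolding finite_levels_def
proof
  fix n
  have "bij_betw f {z \<in> S. w z = n} {z \<in> T. v z = n}"
    using assms(1,2) unfolding bij_betw_def inj_on_def by force
  then show "finite {z \<in> S. w z = n}"
    using bij_betw_finite finite_levelsD[OF assms(3)] by blast
qed

lemma gf_Un:
  assumes "finite_levels w S" "finite_levels w T" "S \<inter> T = {}"
  shows "gf w (S \<union> T) = gf w S + gf w T"
proof (rule fps_ext)
  fix n
  have "{z \<in> S \<union> T. w z = n} = {z \<in> S. w z = n} \<union> {z \<in> T. w z = n}" by auto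
  moreover have "card \<dots> = card {z \<in> S. w z = n} + card {z \<in> T. w z = n}"
    using assms by (intro card_Un_disjoint) (auto simp: finite_levels_def)
  ultimately show "fps_nth (gf w (S \<union> T)) n = fps_nth (gf w S + gf w T) n"
    by (simp add: gf_nth)
qed

lemma gf_UN:
  assumes "finite I" "\<And>i. i \<in> I \<Longrightarrow> finite_levels w (A i)"
    "\<And>i j. i \<in> I \<Longrightarrow> j \<in> I \<Longrightarrow> i \<noteq> j \<Longrightarrow> A i \<inter> A j = {}"
  shows "gf w (\<Union>i\<in>I. A i) = (\<Sum>i\<in>I. gf w (A i))"
proof (rule fps_ext)
  fix n
  have "{z \<in> (\<Union>i\<in>I. A i). w z = n} = (\<Union>i\<in>I. {z \<in> A i. w z = n})" by auto
  moreover have "card \<dots> = (\<Sum>i\<in>I. card {z \<in> A i. w z = n})"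
    using assms by (intro card_UN_disjoint) (auto simp: finite_levels_def, blast)
  ultimately show "fps_nth (gf w (\<Union>i\<in>I. A i)) n = fps_nth (\<Sum>i\<in>I. gf w (A i)) n"
    by (simp add: gf_nth fps_sum_nth)
qed

lemma finite_levels_Un:
  "finite_levels w S \<Longrightarrow> finite_levels w T \<Longrightarrow> finite_levels w (S \<union> T)"
  unfolding finite_levels_def by (simp add: Collect_disj_eq conj_disj_distribR)

lemma gf_scale:
  assumes "k > 0"
  shows "gf (\<lambda>z. k * w z) S = gf w S oo fps_X ^ k"
proof (rule fps_ext)
  fix n
  show "fps_nth (gf (\<lambda>z. k * w z) S) n = fps_nth (gf w S oo fps_X ^ k) n"
  proof (cases "k dvd n")
    case True
    then obtain m where "n = k * m" ..
    then show ?thesis using assms by (simp add: gf_nth fps_nth_compose_X_power)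
  next
    case False
    then have "{z \<in> S. k * w z = n} = {}" by auto
    then show ?thesis using False by (simp only: gf_nth fps_nth_compose_X_power) simp
  qed
qed

text \<open>If \<open>f\<close> acts on \<open>S\<close> with order 3 and each orbit meets \<open>P\<close> at exactly one of its three
  positions, then \<open>S\<close> splits into three translates of its part in \<open>P\<close>. With rotations by a cube root of
  unity for \<open>f\<close>, this compares the theta series of different transversals.\<close>

lemma gf_threefold:
  assumes fin: "finite_levels w S"
    and S: "\<And>z. z \<in> S \<Longrightarrow> f z \<in> S"
    and w: "\<And>z. z \<in> S \<Longrightarrow> w (f z) = w z"
    and f3: "\<And>z. z \<in> S \<Longrightarrow> f (f (f z)) = z"
    and ex: "\<And>z. z \<in> S \<Longrightarrow> P z \<or> P (f z) \<or> P (f (f z))"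
    and un: "\<And>z. z \<in> S \<Longrightarrow> P z \<Longrightarrow> \<not> P (f z)"
  shows "gf w S = 3 * gf w {z \<in> S. P z}"
proof -
  let ?A = "{z \<in> S. P z}" and ?B = "{z \<in> S. P (f z)}" and ?C = "{z \<in> S. P (f (f z))}"
  have fl: "finite_levels w {z \<in> S. Q z}" for Q
    by (rule finite_levels_subset[OF fin]) auto
  have "bij_betw f ?B ?A"
    by (rule bij_betw_byWitness[where f' = "f \<circ> f"]) (use S f3 in auto)
  then have B: "gf w ?B = gf w ?A"
    by (rule gf_bij) (use w in auto)
  have "bij_betw f ?C ?B"
    by (rule bij_betw_byWitness[where f' = "f \<circ> f"]) (use S f3 in auto)
  then have C: "gf w ?C = gf w ?B"
    by (rule gf_bij) (use w in auto)
  have un2: "\<not> P (f (f z))" if "z \<in> S" "P z" for z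
    using un[of "f (f z)"] that S f3 by metis
  have "S = ?A \<union> (?B \<union> ?C)" using ex by auto
  then have "gf w S = gf w (?A \<union> (?B \<union> ?C))" by simp
  also have "\<dots> = gf w ?A + (gf w ?B + gf w ?C)"
  proof -
    have "gf w (?B \<union> ?C) = gf w ?B + gf w ?C"
      by (rule gf_Un[OF fl fl]) (use un S in auto)
    moreover have "gf w (?A \<union> (?B \<union> ?C)) = gf w ?A + gf w (?B \<union> ?C)"
      by (rule gf_Un[OF fl finite_levels_Un[OF fl fl]]) (use un un2 in auto)
    ultimately show ?thesis by simp
  qed
  finally show ?thesis by (simp add: B C)
qed

section \<open>Three-cores and their bead sets\<close>

text \<open>The beta-set of a partition: these are the hook numbers of the first column. It
  determines the partition, and all hook numbers are differences of a bead and a smaller gap.\<close>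

fun beads :: "nat list \<Rightarrow> nat set" where
  "beads [] = {}"
| "beads (x # q) = insert (x + length q) (beads q)"

lemma is_partition_Cons:
  "is_partition (x # q) \<longleftrightarrow> is_partition q \<and> (\<forall>y\<in>set q. y \<le> x) \<and> x > 0"
  by (auto simp: is_partition_def)

lemma finite_beads: "finite (beads p)"
  by (induction p) auto

lemma beads_pos: "is_partition p \<Longrightarrow> 0 \<notin> beads p"
  by (induction p) (auto simp: is_partition_Cons)

lemma beads_less:
  assumes "\<forall>y\<in>set q. y \<le> x" "b \<in> beads q"
  shows "b < x + length q"
  using assms by (induction q) fastforce+

lemma card_beads: "is_partition p \<Longrightarrow> card (beads p) = length p"
proof (induction p)
  case (Cons x q)
  then have "x + length q \<notin> beads q"
    using beads_less[of q x] by (auto simp: is_partition_Cons)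
  with Cons show ?case by (simp add: is_partition_Cons finite_beads)
qed simp

lemma sum_beads: "is_partition p \<Longrightarrow> \<Sum>(beads p) = sum_list p + \<Sum>{..<length p}"
proof (induction p)
  case (Cons x q)
  then have "x + length q \<notin> beads q"
    using beads_less[of q x] by (auto simp: is_partition_Cons)
  with Cons show ?case by (simp add: is_partition_Cons finite_beads)
qed simp

lemma inj_on_beads: "inj_on beads {p. is_partition p}"
proof -
  have "p = q" if "is_partition p" "is_partition q" "beads p = beads q" for p q
    using that
  proof (induction p arbitrary: q)
    case Nil
    then show ?case by (cases q) auto
  next
    case (Cons x p)
    then obtain y q' where q: "q = y # q'" by (cases q) auto
    have len: "length p = length q'"
      using card_beads[of "x # p"] card_beads[of q] Cons.prems by (simp add: q)
    have *: "b < x + length p" if "b \<in> beads p" for b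
      using beads_less[of p x] that Cons.prems by (auto simp: is_partition_Cons)
    have **: "b < y + length q'" if "b \<in> beads q'" for b
      using beads_less[of q' y] that Cons.prems by (auto simp: is_partition_Cons q)
    have eq: "insert (x + length p) (beads p) = insert (y + length q') (beads q')"
      using Cons.prems by (simp add: q)
    have top: "x + length p = y + length q'"
      using eq * ** by (metis insertE insertI1 less_asym)
    then have "beads p = beads q'"
      using eq * ** by (metis insert_ident less_irrefl)
    then show ?case using Cons top len by (simp add: q is_partition_Cons)
  qed
  then show ?thesis by (auto simp: inj_on_def)
qed

lemma ex_partition_beads:
  assumes "finite B" "0 \<notin> B"
  shows "\<exists>p. is_partition p \<and> beads p = B"
  using assms
proof (induction B rule: finite_linorder_max_induct)
  case empty
  then show ?case by (intro exI[of _ "[]"]) (simp add: is_partition_def)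
next
  case (insert b A)
  then obtain q where q: "is_partition q" "beads q = A" by auto
  have len: "length q = card A" using card_beads q by metis
  have "A \<subseteq> {1..<b}" using insert by (auto simp: Suc_le_eq intro: gr0I)
  then have "card A \<le> card {1..<b}" by (intro card_mono) auto
  moreover have "b > 0" using insert by auto
  ultimately have cb: "card A < b" by simp
  have "y \<le> b - card A" if "y \<in> set q" for y
  proof (cases q)
    case (Cons z q')
    then have "z + length q' < b" using q insert by auto
    moreover have "y \<le> z" using that q Cons by (auto simp: is_partition_Cons)
    ultimately show ?thesis using len Cons by simp
  qed (use that in simp)
  then have "is_partition ((b - card A) # q)" using q cb by (simp add: is_partition_Cons)
  moreover have "beads ((b - card A) # q) = insert b A" using q len cb by simp
  ultimately show ?case by blast
qed

lemma filter_le_eq_self: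
  fixes x j :: nat
  assumes "\<forall>y\<in>set q. y \<le> x" "x \<le> j"
  shows "filter (\<lambda>y. y \<le> j) q = q"
proof (rule filter_True, rule ballI)
  fix y assume "y \<in> set q"
  with assms(1) have "y \<le> x" by blast
  with assms(2) show "y \<le> j" by simp
qed

text \<open>Walk along the rim of the Young diagram from its lower left end and number the steps
  0, 1, 2, \<open>\<dots>\<close>. The vertical steps (one per row) carry the beads and the horizontal steps (one per
  column, also beyond the diagram) carry the gaps. Column \<open>j\<close> is preceded by \<open>j\<close> columns and by the
  rows of length at most \<open>j\<close>, which gives its number.\<close>

lemma gaps_of_beads:
  assumes "is_partition q"
  shows "range (\<lambda>j. j + length (filter (\<lambda>y. y \<le> j) q)) = - beads q"
  using assms
proof (induction q)
  case Nil
  then show ?case by simp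
next
  case (Cons x q)
  let ?g = "\<lambda>j. j + length (filter (\<lambda>y. y \<le> j) q)"
  let ?h = "\<lambda>j. j + length (filter (\<lambda>y. y \<le> j) (x # q))"
  have le: "\<forall>y\<in>set q. y \<le> x" using Cons by (simp add: is_partition_Cons)
  have full: "?g j = j + length q" if "j \<ge> x" for j
    using filter_le_eq_self[OF le that] by simp
  have short: "?g j < x + length q" if "j < x" for j
    using that length_filter_le[of "\<lambda>y. y \<le> j" q] by linarith
  have hs: "?h j = (if j < x then ?g j else Suc (j + length q))" for j
    using full[of j] by simp
  have IH: "c \<notin> beads q \<longleftrightarrow> (\<exists>j. c = ?g j)" for c
    using Cons by (auto simp: is_partition_Cons set_eq_iff)
  show ?case
  proof (rule set_eqI)
    fix c
    have "(\<exists>j. c = ?h j) \<longleftrightarrow> (\<exists>j<x. c = ?g j) \<or> c > x + length q"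
      unfolding hs
    proof -
      have "(\<exists>j. c = Suc (j + length q) \<and> \<not> j < x) \<longleftrightarrow> c > x + length q"
        by (auto intro!: exI[of _ "c - Suc (length q)"])
      then show "(\<exists>j. c = (if j < x then ?g j else Suc (j + length q))) \<longleftrightarrow>
          (\<exists>j<x. c = ?g j) \<or> c > x + length q"
        by (metis (no_types))
    qed
    moreover have "(\<exists>j. c = ?g j) \<longleftrightarrow> (\<exists>j<x. c = ?g j) \<or> c \<ge> x + length q"
    proof
      assume "\<exists>j. c = ?g j"
      then obtain j where j: "c = ?g j" ..
      show "(\<exists>j<x. c = ?g j) \<or> c \<ge> x + length q"
        using j full[of j] by (cases "j < x") auto
    next
      assume "(\<exists>j<x. c = ?g j) \<or> c \<ge> x + length q"
      then show "\<exists>j. c = ?g j"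
      proof
        assume "c \<ge> x + length q"
        then have "c = ?g (c - length q)" using full[of "c - length q"] by linarith
        then show ?thesis by blast
      qed blast
    qed
    moreover have "((\<exists>j<x. c = ?g j) \<or> c > x + length q) \<longleftrightarrow>
        c \<noteq> x + length q \<and> ((\<exists>j<x. c = ?g j) \<or> c \<ge> x + length q)"
    proof -
      have "(\<exists>j<x. c = ?g j) \<Longrightarrow> c < x + length q" using short by blast
      then show ?thesis by (cases "c = x + length q") (blast, auto)
    qed
    moreover have "c \<in> range ?h \<longleftrightarrow> (\<exists>j. c = ?h j)" by blast
    moreover have "c \<in> - beads (x # q) \<longleftrightarrow> c \<noteq> x + length q \<and> (\<exists>j. c = ?g j)"
      using IH[of c] by simp
    ultimately show "c \<in> range ?h \<longleftrightarrow> c \<in> - beads (x # q)" by argo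
  qed
qed

lemma hook_number_Cons_Suc: "hook_number (x # q) (Suc i, j) = hook_number q (i, j)"
proof -
  have "hook (x # q) (Suc i, j) = (\<lambda>(k, l). (Suc k, l)) ` hook q (i, j)"
  proof (rule set_eqI)
    fix c :: "nat \<times> nat"
    obtain k l where c: "c = (k, l)" by (cases c)
    show "c \<in> hook (x # q) (Suc i, j) \<longleftrightarrow> c \<in> (\<lambda>(k, l). (Suc k, l)) ` hook q (i, j)"
      unfolding c by (cases k) (auto simp: hook_def cells_def image_iff)
  qed
  moreover have "inj_on (\<lambda>(k, l). (Suc k, l)) (hook q (i, j))" by (auto simp: inj_on_def)
  ultimately show ?thesis by (simp add: hook_number_def card_image)
qed

lemma hook_number_Cons_0:
  assumes "j < x"
  shows "hook_number (x # q) (0, j) + (j + length (filter (\<lambda>y. y \<le> j) q)) = x + length q"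
proof -
  have "hook (x # q) (0, j) =
      Pair 0 ` {j..<x} \<union> (\<lambda>k. (Suc k, j)) ` {k. k < length q \<and> j < q ! k}"
  proof (rule set_eqI)
    fix c :: "nat \<times> nat"
    obtain k l where c: "c = (k, l)" by (cases c)
    show "c \<in> hook (x # q) (0, j) \<longleftrightarrow>
      c \<in> Pair 0 ` {j..<x} \<union> (\<lambda>k. (Suc k, j)) ` {k. k < length q \<and> j < q ! k}"
      unfolding c using assms by (cases k) (auto simp: hook_def cells_def image_iff)
  qed
  also have "card \<dots> = card {j..<x} + card {k. k < length q \<and> j < q ! k}"
    by (subst card_Un_disjoint) (auto simp: card_image inj_on_def)
  finally have "hook_number (x # q) (0, j) = (x - j) + length (filter (\<lambda>y. y > j) q)"
    by (simp add: hook_number_def length_filter_conv_card)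
  moreover have "length (filter (\<lambda>y. y \<le> j) q) + length (filter (\<lambda>y. y > j) q) = length q"
    using sum_length_filter_compl[of "\<lambda>y. y \<le> j" q] by (simp add: not_le)
  ultimately show ?thesis using assms by simp
qed

lemma cells_Cons: "cells (x # q) = Pair 0 ` {..<x} \<union> (\<lambda>(i, j). (Suc i, j)) ` cells q"
proof (rule set_eqI)
  fix c :: "nat \<times> nat"
  obtain k l where c: "c = (k, l)" by (cases c)
  show "c \<in> cells (x # q) \<longleftrightarrow> c \<in> Pair 0 ` {..<x} \<union> (\<lambda>(i, j). (Suc i, j)) ` cells q"
    unfolding c by (cases k) (auto simp: cells_def image_iff)
qed

text \<open>The hook of a cell runs along the rim from the step of its column to the step of its row,
  so its size is the difference of the numbers of the two steps.\<close>

lemma row_0_hooks: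
  assumes "is_partition (x # q)"
  shows "(\<lambda>j. hook_number (x # q) (0, j)) ` {..<x} =
    (\<lambda>c. x + length q - c) ` ({..<x + length q} - beads q)"
proof -
  let ?g = "\<lambda>j. j + length (filter (\<lambda>y. y \<le> j) q)"
  have part: "is_partition q" and le: "\<forall>y\<in>set q. y \<le> x"
    using assms by (simp_all add: is_partition_Cons)
  have full: "?g j = j + length q" if "j \<ge> x" for j
    using filter_le_eq_self[OF le that] by simp
  have lt: "?g j < x + length q \<longleftrightarrow> j < x" for j
    using full[of j] length_filter_le[of "\<lambda>y. y \<le> j" q] by (cases "j < x") linarith+
  have "{..<x + length q} - beads q = ?g ` {..<x}"
    using gaps_of_beads[OF part] lt by (fastforce simp: set_eq_iff image_iff)
  then have "(\<lambda>c. x + length q - c) ` ({..<x + length q} - beads q) =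
      (\<lambda>j. x + length q - ?g j) ` {..<x}" by (simp add: image_image)
  also have "\<dots> = (\<lambda>j. hook_number (x # q) (0, j)) ` {..<x}"
  proof (rule image_cong)
    fix j assume "j \<in> {..<x}"
    then show "x + length q - ?g j = hook_number (x # q) (0, j)"
      using hook_number_Cons_0[of j x q] by simp
  qed simp
  finally show ?thesis by simp
qed

text \<open>The rows below the first form a partition of their own with the same hooks, so the
  description of the first row extends to all rows by induction.\<close>

lemma is_core_iff_beads:
  assumes "is_partition p"
  shows "is_core t p \<longleftrightarrow> (\<forall>b\<in>beads p. \<forall>c<b. c \<notin> beads p \<longrightarrow> \<not> t dvd b - c)"
proof -
  have "(\<forall>c\<in>cells p. \<not> t dvd hook_number p c) \<longleftrightarrow>
      (\<forall>b\<in>beads p. \<forall>c<b. c \<notin> beads p \<longrightarrow> \<not> t dvd b - c)"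
    using assms
  proof (induction p)
    case Nil
    then show ?case by (simp add: cells_def)
  next
    case (Cons x q)
    have below: "b < x + length q" if "b \<in> beads q" for b
      using beads_less[of q x] that Cons.prems by (auto simp: is_partition_Cons)
    have "(\<forall>c\<in>cells (x # q). \<not> t dvd hook_number (x # q) c) \<longleftrightarrow>
      (\<forall>h\<in>(\<lambda>j. hook_number (x # q) (0, j)) ` {..<x}. \<not> t dvd h) \<and>
      (\<forall>c\<in>cells q. \<not> t dvd hook_number q c)"
      by (auto simp: cells_Cons ball_Un hook_number_Cons_Suc)
    also have "\<dots> \<longleftrightarrow> (\<forall>c<x + length q. c \<notin> beads q \<longrightarrow> \<not> t dvd x + length q - c) \<and>
      (\<forall>b\<in>beads q. \<forall>c<b. c \<notin> beads q \<longrightarrow> \<not> t dvd b - c)"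
      unfolding row_0_hooks[OF Cons.prems] using Cons by (auto simp: is_partition_Cons)
    also have "\<dots> \<longleftrightarrow> (\<forall>b\<in>beads (x # q). \<forall>c<b. c \<notin> beads (x # q) \<longrightarrow> \<not> t dvd b - c)"
    proof -
      have "c \<noteq> x + length q" if "b \<in> beads q" "c < b" for b c
        using below[OF that(1)] that(2) by simp
      then show ?thesis using below by auto
    qed
    finally show ?case .
  qed
  then show ?thesis using assms by (simp add: is_core_def)
qed

text \<open>A bead set in which no bead lies a multiple of 3 above a gap is closed under
  subtracting 3. It avoids 0, hence all multiples of 3, and fills initial segments of the two
  remaining residue classes.\<close>

definition runners :: "nat \<times> nat \<Rightarrow> nat set" where
  "runners rs = (\<lambda>i. 3 * i + 1) ` {..<fst rs} \<union> (\<lambda>i. 3 * i + 2) ` {..<snd rs}"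

lemma mem_runners:
  "b \<in> runners (r, s) \<longleftrightarrow> b mod 3 = 1 \<and> b div 3 < r \<or> b mod 3 = 2 \<and> b div 3 < s"
proof -
  have mem: "b \<in> runners (r, s) \<longleftrightarrow> (\<exists>i<r. b = 3 * i + 1) \<or> (\<exists>i<s. b = 3 * i + 2)"
    by (auto simp: runners_def)
  have "(\<exists>i<n. b = 3 * i + k) \<longleftrightarrow> b mod 3 = k \<and> b div 3 < n" if "k < 3" for k n
    using that mult_div_mod_eq[of 3 b] by (metis div_mult_self4 div_less add_0_right
        mod_mult_self2_is_0 mod_less mod_mult_self4 add.commute zero_neq_numeral)
  from this[of 1 r] this[of 2 s]
  have "(\<exists>i<r. b = 3 * i + 1) \<longleftrightarrow> b mod 3 = 1 \<and> b div 3 < r"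
    "(\<exists>i<s. b = 3 * i + 2) \<longleftrightarrow> b mod 3 = 2 \<and> b div 3 < s" by simp_all
  with mem show ?thesis by argo
qed

lemma down_closed_interval:
  assumes "finite A" "\<And>i. Suc i \<in> A \<Longrightarrow> i \<in> A"
  shows "\<exists>r. A = {..<r::nat}"
proof (cases "A = {}")
  case False
  have down: "i \<in> A" if "i + d \<in> A" for i d
    using that by (induction d) (auto intro: assms(2))
  have "A = {..<Suc (Max A)}"
  proof (intro equalityI subsetI)
    fix i assume "i \<in> {..<Suc (Max A)}"
    then have "i + (Max A - i) \<in> A" using Max_in[OF assms(1) False] by simp
    then show "i \<in> A" by (rule down)
  qed (use assms(1) in \<open>simp add: less_Suc_eq_le\<close>)
  then show ?thesis ..
qed auto

lemma ex_runners:
  assumes "finite B" "0 \<notin> B"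
    and closed: "\<forall>b\<in>B. \<forall>c<b. c \<notin> B \<longrightarrow> \<not> 3 dvd b - c"
  shows "\<exists>rs. B = runners rs"
proof -
  have step: "b \<in> B" if "b + 3 \<in> B" for b
    using closed[rule_format, of "b + 3" b] that by auto
  have fin: "finite {i. 3 * i + k \<in> B}" for k
  proof (rule finite_subset)
    show "{i. 3 * i + k \<in> B} \<subseteq> {..Max B}"
      using Max_ge[OF assms(1)] by fastforce
  qed simp
  have "\<exists>r. {i. 3 * i + k \<in> B} = {..<r}" for k
  proof (rule down_closed_interval[OF fin])
    fix i assume "Suc i \<in> {i. 3 * i + k \<in> B}"
    then show "i \<in> {i. 3 * i + k \<in> B}" using step[of "3 * i + k"] by (simp add: algebra_simps)
  qed
  then obtain r s where "{i. 3 * i + 1 \<in> B} = {..<r}" "{i. 3 * i + 2 \<in> B} = {..<s}" by metis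
  then have r: "3 * i + 1 \<in> B \<longleftrightarrow> i < r" and s: "3 * i + 2 \<in> B \<longleftrightarrow> i < s" for i
    by (simp_all only: set_eq_iff mem_Collect_eq lessThan_iff)
  have zero: "3 * i \<notin> B" for i
  proof (induction i)
    case (Suc i)
    then show ?case using step[of "3 * i"] by (auto simp: algebra_simps)
  qed (use assms(2) in simp)
  have "b \<in> B \<longleftrightarrow> b \<in> runners (r, s)" for b
  proof -
    have b: "b = 3 * (b div 3) + b mod 3" by simp
    have "b mod 3 = 0 \<or> b mod 3 = 1 \<or> b mod 3 = 2" by linarith
    then show ?thesis
    proof (elim disjE)
      assume m: "b mod 3 = 0"
      with b zero[of "b div 3"] show ?thesis by (simp add: mem_runners)
    next
      assume m: "b mod 3 = 1"
      with b r[of "b div 3"] show ?thesis by (simp add: mem_runners)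
    next
      assume m: "b mod 3 = 2"
      with b s[of "b div 3"] show ?thesis by (simp add: mem_runners)
    qed
  qed
  then show ?thesis by blast
qed

lemma runners_closed:
  assumes "b \<in> runners rs" "c < b" "c \<notin> runners rs"
  shows "\<not> 3 dvd b - c"
proof
  assume "3 dvd b - c"
  then have "c mod 3 = b mod 3" using assms(2) by (metis mod_eq_dvd_iff_nat less_imp_le)
  moreover have "c div 3 \<le> b div 3" using assms(2) by (simp add: div_le_mono)
  ultimately show False using assms by (cases rs) (auto simp: mem_runners)
qed

lemma inj_runners: "inj runners"
proof (rule injI)
  fix x y assume eq: "runners x = runners y"
  obtain r s where x: "x = (r, s)" by (cases x)
  obtain r' s' where y: "y = (r', s')" by (cases y)
  have "3 * i + 1 \<in> runners x \<longleftrightarrow> i < r" "3 * i + 1 \<in> runners y \<longleftrightarrow> i < r'"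
    "3 * i + 2 \<in> runners x \<longleftrightarrow> i < s" "3 * i + 2 \<in> runners y \<longleftrightarrow> i < s'" for i
    unfolding x y mem_runners by presburger+
  then have "i < r \<longleftrightarrow> i < r'" "i < s \<longleftrightarrow> i < s'" for i
    using eq by simp_all
  then show "x = y" unfolding x y by (metis less_irrefl linorder_neqE_nat)
qed

lemma finite_runners: "finite (runners rs)"
  by (simp add: runners_def)

lemma disjoint_runners: "3 * i \<noteq> Suc (3 * j)"
  by presburger

lemma card_runners: "card (runners (r, s)) = r + s"
  unfolding runners_def by (subst card_Un_disjoint) (auto simp: card_image inj_on_def disjoint_runners)

lemma sum_runners: "\<Sum>(runners (r, s)) = (\<Sum>i<r. 3 * i + 1) + (\<Sum>i<s. 3 * i + 2)"
  unfolding runners_def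
  by (subst sum.union_disjoint) (auto simp: sum.reindex inj_on_def disjoint_runners)

definition core_of :: "nat \<times> nat \<Rightarrow> nat list" where
  "core_of rs = (THE p. is_partition p \<and> beads p = runners rs)"

lemma core_of: "is_partition (core_of rs)" "beads (core_of rs) = runners rs"
proof -
  have "0 \<notin> runners rs" by (cases rs) (simp add: mem_runners)
  then have "\<exists>!p. is_partition p \<and> beads p = runners rs"
    using ex_partition_beads[OF finite_runners, of rs] inj_on_beads
    by (auto simp only: inj_on_def mem_Collect_eq)
  from theI'[OF this] show "is_partition (core_of rs)" "beads (core_of rs) = runners rs"
    unfolding core_of_def by auto
qed

lemma bij_betw_core_of: "bij_betw core_of UNIV {p. is_core 3 p}"
  unfolding bij_betw_def
proof
  show "inj core_of"
    by (rule injI) (metis core_of(2) inj_runners injD)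
  show "range core_of = {p. is_core 3 p}"
  proof (intro equalityI subsetI)
    fix p assume "p \<in> range core_of"
    then show "p \<in> {p. is_core 3 p}"
      using core_of is_core_iff_beads runners_closed by auto
  next
    fix p assume "p \<in> {p. is_core 3 p}"
    then have core: "is_core 3 p" and part: "is_partition p" by (auto simp: is_core_def)
    obtain rs where "beads p = runners rs"
      using ex_runners[OF finite_beads beads_pos[OF part]] core is_core_iff_beads[OF part]
      by blast
    then have "p = core_of rs"
      using core_of[of rs] part inj_on_beads by (auto simp: inj_on_def)
    then show "p \<in> range core_of" by simp
  qed
qed

lemma sum_list_core_of: "int (sum_list (core_of (r, s))) = int r ^ 2 - int r * int s + int s ^ 2 + int s"
proof -
  have gauss: "2 * (\<Sum>i<n. int i) = int n * (int n - 1)" for n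
    by (induction n) (auto simp: algebra_simps)
  have "length (core_of (r, s)) = r + s"
    using card_beads[OF core_of(1), of "(r, s)"] by (simp add: core_of card_runners)
  then have "\<Sum>(runners (r, s)) = sum_list (core_of (r, s)) + \<Sum>{..<r + s}"
    using sum_beads[OF core_of(1), of "(r, s)"] by (simp add: core_of)
  then have "int (\<Sum>i<r. 3 * i + 1) + int (\<Sum>i<s. 3 * i + 2) =
      int (sum_list (core_of (r, s))) + int (\<Sum>{..<r + s})"
    unfolding sum_runners by linarith
  then have "2 * int (sum_list (core_of (r, s))) + 2 * (\<Sum>i<r + s. int i) =
     3 * (2 * (\<Sum>i<r. int i)) + 2 * int r + 3 * (2 * (\<Sum>i<s. int i)) + 4 * int s"
    by (simp add: sum.distrib sum_distrib_left[symmetric])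
  then show ?thesis unfolding gauss by (simp add: algebra_simps power2_eq_square)
qed


section \<open>Eisenstein integers and their residue classes\<close>

text \<open>The pair \<open>(x, y)\<close> stands for \<open>x + y w\<close>; \<open>rot\<close> is multiplication by \<open>w\<close>.\<close>

definition eis_norm :: "int \<times> int \<Rightarrow> nat" where
  "eis_norm z = nat ((fst z)\<^sup>2 - fst z * snd z + (snd z)\<^sup>2)"

definition rot :: "int \<times> int \<Rightarrow> int \<times> int" where
  "rot z = (- snd z, fst z - snd z)"

lemma int_eis_norm: "int (eis_norm (x, y)) = x\<^sup>2 - x * y + y\<^sup>2"
proof -
  have "4 * (x\<^sup>2 - x * y + y\<^sup>2) = (2 * x - y)\<^sup>2 + 3 * y\<^sup>2"
    by (simp add: power2_eq_square algebra_simps)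
  then have "x\<^sup>2 - x * y + y\<^sup>2 \<ge> 0"
    by (smt (verit) zero_le_power2)
  then show ?thesis by (simp add: eis_norm_def)
qed

lemma eis_norm_rot: "eis_norm (rot z) = eis_norm z"
  by (simp add: eis_norm_def rot_def power2_eq_square algebra_simps)

lemma rot_rot_rot: "rot (rot (rot z)) = z"
  by (simp add: rot_def)

lemma finite_levels_eis_norm: "finite_levels eis_norm S"
proof (rule finite_levels_subset)
  have coord: "\<bar>y\<bar> \<le> 2 * n" if "x\<^sup>2 - x * y + y\<^sup>2 = n" for x y n :: int
  proof -
    have "4 * n = (2 * x - y)\<^sup>2 + 3 * y\<^sup>2"
      using that by (simp add: power2_eq_square algebra_simps)
    moreover have "\<bar>y\<bar> \<le> y\<^sup>2"
      by (metis abs_le_square_iff abs_ge_zero abs_of_nonneg power2_abs power2_eq_square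
          mult_le_cancel_left1 abs_eq_0 not_less zero_less_abs_iff int_one_le_iff_zero_less)
    ultimately show ?thesis by (smt (verit) zero_le_power2)
  qed
  show "finite_levels eis_norm UNIV"
    unfolding finite_levels_def
  proof
    fix n
    have "{z \<in> UNIV. eis_norm z = n} \<subseteq> {- 2 * int n..2 * int n} \<times> {- 2 * int n..2 * int n}"
    proof clarify
      fix x y assume "n = eis_norm (x, y)"
      then have n: "x\<^sup>2 - x * y + y\<^sup>2 = int n" by (simp add: int_eis_norm)
      then have "y\<^sup>2 - y * x + x\<^sup>2 = int n" by (simp add: algebra_simps)
      from coord[OF n] coord[OF this]
      show "x \<in> {- 2 * int (eis_norm (x, y))..2 * int (eis_norm (x, y))} \<and>
          y \<in> {- 2 * int (eis_norm (x, y))..2 * int (eis_norm (x, y))}"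
        using \<open>n = eis_norm (x, y)\<close> by auto
    qed
    then show "finite {z \<in> UNIV. eis_norm z = n}" by (rule finite_subset) simp
  qed
qed simp

text \<open>Since \<open>w\<close> is 1 modulo \<open>\<theta>\<close>, the residue of \<open>x + y w\<close> modulo \<open>\<theta>\<close> is that of \<open>x + y\<close> modulo 3.\<close>

definition theta_class :: "int \<Rightarrow> (int \<times> int) set" where
  "theta_class i = {z. 3 dvd fst z + snd z - i}"

definition class_mod_2theta :: "int \<Rightarrow> int \<Rightarrow> int \<Rightarrow> (int \<times> int) set" where
  "class_mod_2theta i a b = {z. 3 dvd fst z + snd z - i \<and> 2 dvd fst z - a \<and> 2 dvd snd z - b}"

text \<open>The series \<open>F\<^sub>i\<close> and \<open>G\<^sub>i\<close> of the introduction.\<close>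

abbreviation even_theta :: "int \<Rightarrow> int fps" where
  "even_theta i \<equiv> gf eis_norm (class_mod_2theta i 0 0)"

abbreviation odd_theta :: "int \<Rightarrow> int fps" where
  "odd_theta i \<equiv> gf eis_norm (class_mod_2theta i 1 0)"

lemma mem_class_mod_2theta:
  "(x, y) \<in> class_mod_2theta i a b \<longleftrightarrow> 3 dvd x + y - i \<and> 2 dvd x - a \<and> 2 dvd y - b"
  by (simp add: class_mod_2theta_def)

lemma mem_theta_class: "(x, y) \<in> theta_class i \<longleftrightarrow> 3 dvd x + y - i"
  by (simp add: theta_class_def)

lemma gf_class_mod_2theta_cong:
  assumes "3 dvd i - j" "2 dvd a - c" "2 dvd b - d"
  shows "gf eis_norm (class_mod_2theta i a b) = gf eis_norm (class_mod_2theta j c d)"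
proof -
  have "3 dvd x - i \<longleftrightarrow> 3 dvd x - j" "2 dvd x - a \<longleftrightarrow> 2 dvd x - c"
    "2 dvd x - b \<longleftrightarrow> 2 dvd x - d" for x
    using assms by presburger+
  then have "class_mod_2theta i a b = class_mod_2theta j c d" by (auto simp: class_mod_2theta_def)
  then show ?thesis by simp
qed

lemma gf_class_mod_2theta_rot:
  "gf eis_norm (class_mod_2theta i a b) = gf eis_norm (class_mod_2theta i (- b) (a - b))"
proof (rule gf_bij)
  show "bij_betw rot (class_mod_2theta i a b) (class_mod_2theta i (- b) (a - b))"
    by (rule bij_betw_byWitness[where f' = "rot \<circ> rot"])
      (auto simp: rot_rot_rot, auto simp: rot_def class_mod_2theta_def, presburger+)
qed (rule eis_norm_rot)

lemma gf_class_mod_2theta_uminus: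
  "gf eis_norm (class_mod_2theta i a b) = gf eis_norm (class_mod_2theta (- i) a b)"
proof (rule gf_bij)
  show "bij_betw (\<lambda>z. (- fst z, - snd z)) (class_mod_2theta i a b) (class_mod_2theta (- i) a b)"
    by (rule bij_betw_byWitness[where f' = "\<lambda>z. (- fst z, - snd z)"])
      (auto simp: class_mod_2theta_def, presburger+)
qed (simp add: eis_norm_def)

lemma gf_odd_classes:
  "gf eis_norm (class_mod_2theta i 0 1) = odd_theta i"
  "gf eis_norm (class_mod_2theta i 1 1) = odd_theta i"
proof -
  show 1: "gf eis_norm (class_mod_2theta i 0 1) = odd_theta i"
    using gf_class_mod_2theta_rot[of i 1 0] by simp
  have "gf eis_norm (class_mod_2theta i 0 1) = gf eis_norm (class_mod_2theta i 1 1)"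
    unfolding gf_class_mod_2theta_rot[of i 0 1] by (rule gf_class_mod_2theta_cong) auto
  with 1 show "gf eis_norm (class_mod_2theta i 1 1) = odd_theta i" by simp
qed

lemma classes_2: "odd_theta 2 = odd_theta 1" "even_theta 2 = even_theta 1"
  using gf_class_mod_2theta_uminus[of 1] gf_class_mod_2theta_cong[of 2 "-1"] by simp_all

section \<open>A cubic relation between theta series\<close>

text \<open>A pair \<open>(\<alpha>, \<beta>)\<close> of elements that agree modulo 2 equals \<open>(\<gamma> + \<delta>, \<gamma> - \<delta>)\<close> for unique \<open>\<gamma>\<close> and \<open>\<delta>\<close>, and
  the parallelogram law doubles the sum of norms. Modulo \<open>\<theta>\<close>, dividing by 2 is changing the sign; modulo 2
  only \<open>\<gamma> + \<delta>\<close> is prescribed, whence the sum over the four classes of \<open>\<gamma>\<close>.\<close>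

lemma class_mod_2theta_product:
  "gf eis_norm (class_mod_2theta i a b) * gf eis_norm (class_mod_2theta j a b) =
    (\<Sum>(c, d)\<in>{0, 1} \<times> {0, 1}. gf eis_norm (class_mod_2theta (- i - j) c d) *
       gf eis_norm (class_mod_2theta (j - i) (a - c) (b - d))) oo fps_X ^ 2"
proof -
  let ?f = "\<lambda>((x, y), (u, v)). ((x + u, y + v), (x - u, y - v)) :: (int \<times> int) \<times> (int \<times> int)"
  let ?g = "\<lambda>((x, y), (u, v)). (((x + u) div 2, (y + v) div 2), ((x - u) div 2, (y - v) div 2))
    :: (int \<times> int) \<times> (int \<times> int)"
  let ?R = "\<Union>(c, d)\<in>{0, 1} \<times> {0, 1}. class_mod_2theta (- i - j) c d \<times> class_mod_2theta (j - i) (a - c) (b - d)"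
  let ?w = "eis_norm \<oplus>w eis_norm"
  have par: "(\<exists>c\<in>{0, 1}. \<exists>d\<in>{0, 1}. 2 dvd x - c \<and> 2 dvd y - d \<and> 2 dvd u - (a - c) \<and> 2 dvd v - (b - d))
      \<longleftrightarrow> 2 dvd x + u - a \<and> 2 dvd y + v - b" for x y u v :: int
  proof -
    have "(2 dvd x - 0 \<and> 2 dvd u - (a - 0) \<or> 2 dvd x - 1 \<and> 2 dvd u - (a - 1)) \<longleftrightarrow> 2 dvd x + u - a"
      "(2 dvd y - 0 \<and> 2 dvd v - (b - 0) \<or> 2 dvd y - 1 \<and> 2 dvd v - (b - 1)) \<longleftrightarrow> 2 dvd y + v - b"
      by presburger+
    then show ?thesis by blast
  qed
  have R: "((x, y), (u, v)) \<in> ?R \<longleftrightarrow> 3 dvd x + y + i + j \<and> 3 dvd u + v - j + i \<and>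
      2 dvd x + u - a \<and> 2 dvd y + v - b" for x y u v
    unfolding par[symmetric] by (auto simp: mem_class_mod_2theta algebra_simps)
  have mod3: "3 dvd s + i + j \<and> 3 dvd d - j + i \<longleftrightarrow> 3 dvd s + d - i \<and> 3 dvd s - d - j"
    for s d :: int
    by presburger
  have "bij_betw ?f ?R (class_mod_2theta i a b \<times> class_mod_2theta j a b)"
  proof (rule bij_betw_byWitness[where f' = ?g])
    show "\<forall>z\<in>?R. ?g (?f z) = z" by auto
    show "\<forall>z\<in>class_mod_2theta i a b \<times> class_mod_2theta j a b. ?f (?g z) = z"
    proof
      fix z assume "z \<in> class_mod_2theta i a b \<times> class_mod_2theta j a b"
      moreover obtain x y u v where z: "z = ((x, y), (u, v))" by (metis surj_pair)
      ultimately have "2 dvd x - a" "2 dvd u - a" "2 dvd y - b" "2 dvd v - b"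
        by (simp_all add: mem_class_mod_2theta)
      then have "(x + u) div 2 + (x - u) div 2 = x" "(x + u) div 2 - (x - u) div 2 = u"
        "(y + v) div 2 + (y - v) div 2 = y" "(y + v) div 2 - (y - v) div 2 = v"
        by presburger+
      then show "?f (?g z) = z" by (simp add: z)
    qed
    show "?f ` ?R \<subseteq> class_mod_2theta i a b \<times> class_mod_2theta j a b"
    proof (rule image_subsetI)
      fix z assume "z \<in> ?R"
      moreover obtain x y u v where z: "z = ((x, y), (u, v))" by (metis surj_pair)
      ultimately have "3 dvd x + y + i + j \<and> 3 dvd u + v - j + i"
        and par: "2 dvd x + u - a" "2 dvd y + v - b" unfolding z R by blast+
      then have "3 dvd (x + y) + (u + v) - i" "3 dvd (x + y) - (u + v) - j"
        unfolding mod3 by auto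
      moreover have "2 dvd x - u - a" "2 dvd y - v - b" using par by presburger+
      ultimately show "?f z \<in> class_mod_2theta i a b \<times> class_mod_2theta j a b"
        using par by (simp add: z mem_class_mod_2theta algebra_simps)
    qed
    show "?g ` (class_mod_2theta i a b \<times> class_mod_2theta j a b) \<subseteq> ?R"
    proof (rule image_subsetI)
      fix z assume mem: "z \<in> class_mod_2theta i a b \<times> class_mod_2theta j a b"
      obtain x y u v where z: "z = ((x, y), (u, v))" by (metis surj_pair)
      have "2 dvd x - a" "2 dvd u - a" "2 dvd y - b" "2 dvd v - b"
        using mem by (simp_all add: z mem_class_mod_2theta)
      then have "\<exists>p q. x = p + q \<and> u = p - q" "\<exists>r t. y = r + t \<and> v = r - t" by presburger+
      then obtain p q r t where e: "x = p + q" "u = p - q" "y = r + t" "v = r - t" by blast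
      have "3 dvd (p + r) + (q + t) - i \<and> 3 dvd (p + r) - (q + t) - j"
        and "2 dvd p + q - a" "2 dvd r + t - b"
        using mem by (simp_all add: z e mem_class_mod_2theta algebra_simps)
      then have "((p, r), (q, t)) \<in> ?R" unfolding R mod3[symmetric] by auto
      then show "?g z \<in> ?R" by (simp add: z e)
    qed
  qed
  then have "gf (\<lambda>z. 2 * ?w z) ?R = gf ?w (class_mod_2theta i a b \<times> class_mod_2theta j a b)"
  proof (rule gf_bij)
    fix z :: "(int \<times> int) \<times> (int \<times> int)"
    obtain x y u v where z: "z = ((x, y), (u, v))" by (metis surj_pair)
    have "int (?w (?f z)) = int (2 * ?w z)"
      by (simp add: z int_eis_norm power2_eq_square algebra_simps)
    then show "?w (?f z) = 2 * ?w z" by linarith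
  qed
  moreover have "gf (\<lambda>z. 2 * ?w z) ?R = gf ?w ?R oo fps_X ^ 2"
    by (rule gf_scale) simp
  moreover have "gf ?w ?R = (\<Sum>(c, d)\<in>{0, 1} \<times> {0, 1}. gf eis_norm (class_mod_2theta (- i - j) c d) *
       gf eis_norm (class_mod_2theta (j - i) (a - c) (b - d)))"
    by (subst gf_UN)
      (auto simp: gf_product finite_levels_eis_norm finite_levels_product mem_class_mod_2theta)
  ultimately show ?thesis by (simp add: gf_product finite_levels_eis_norm)
qed

lemma product_formulas:
  shows "odd_theta 1 * odd_theta 1 = (even_theta 1 * odd_theta 0 + odd_theta 1 * even_theta 0 + 2 * odd_theta 1 * odd_theta 0) oo fps_X ^ 2"
    and "odd_theta 0 * odd_theta 1 = (2 * odd_theta 1 * even_theta 1 + 2 * odd_theta 1 * odd_theta 1) oo fps_X ^ 2"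
    and "even_theta 1 * even_theta 1 = (even_theta 1 * even_theta 0 + 3 * odd_theta 1 * odd_theta 0) oo fps_X ^ 2"
    and "even_theta 0 * even_theta 1 = (even_theta 1 * even_theta 1 + 3 * odd_theta 1 * odd_theta 1) oo fps_X ^ 2"
proof -
  have c: "gf eis_norm (class_mod_2theta i (-1) b) = gf eis_norm (class_mod_2theta i 1 b)"
    "gf eis_norm (class_mod_2theta i a (-1)) = gf eis_norm (class_mod_2theta i a 1)"
    "gf eis_norm (class_mod_2theta (-2) a b) = gf eis_norm (class_mod_2theta 1 a b)"
    "gf eis_norm (class_mod_2theta (-1) a b) = gf eis_norm (class_mod_2theta 1 a b)" for i a b
    using gf_class_mod_2theta_uminus[of 1 a b]
    by (simp_all only: gf_class_mod_2theta_cong[of i i "-1" 1 b b, simplified] gf_class_mod_2theta_cong[of "-2" 1 a a b b, simplified]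
      gf_class_mod_2theta_cong[of i i a a "-1" 1, simplified])
  note s = gf_odd_classes c algebra_simps
  show "odd_theta 1 * odd_theta 1 = (even_theta 1 * odd_theta 0 + odd_theta 1 * even_theta 0 + 2 * odd_theta 1 * odd_theta 0) oo fps_X ^ 2"
    using class_mod_2theta_product[of 1 1 0 1] by (simp add: s)
  show "odd_theta 0 * odd_theta 1 = (2 * odd_theta 1 * even_theta 1 + 2 * odd_theta 1 * odd_theta 1) oo fps_X ^ 2"
    using class_mod_2theta_product[of 0 1 0 1] by (simp add: s)
  show "even_theta 1 * even_theta 1 = (even_theta 1 * even_theta 0 + 3 * odd_theta 1 * odd_theta 0) oo fps_X ^ 2"
    using class_mod_2theta_product[of 1 0 0 1] by (simp add: s)
  show "even_theta 0 * even_theta 1 = (even_theta 1 * even_theta 1 + 3 * odd_theta 1 * odd_theta 1) oo fps_X ^ 2"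
    using class_mod_2theta_product[of 0 0 0 1] by (simp add: s)
qed


text \<open>Norms are squares modulo 3, and odd exactly off the multiples of 2, so each of the four
  series lives in a single residue class of degrees modulo 6.\<close>

definition supported_mod_6 :: "nat \<Rightarrow> int fps \<Rightarrow> bool" where
  "supported_mod_6 r f \<longleftrightarrow> (\<forall>n. fps_nth f n \<noteq> 0 \<longrightarrow> n mod 6 = r mod 6)"

lemma supported_mod_6_mult:
  assumes "supported_mod_6 r f" "supported_mod_6 s g"
  shows "supported_mod_6 (r + s) (f * g)"
  unfolding supported_mod_6_def
proof clarify
  fix n assume "fps_nth (f * g) n \<noteq> 0"
  then obtain i where "i \<in> {0..n}" "fps_nth f i * fps_nth g (n - i) \<noteq> 0"
    unfolding fps_mult_nth by (meson sum.neutral)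
  then have i: "i \<le> n" "i mod 6 = r mod 6" "(n - i) mod 6 = s mod 6"
    using assms by (auto simp: supported_mod_6_def)
  then have "(i + (n - i)) mod 6 = (r + s) mod 6" by (metis mod_add_eq)
  then show "n mod 6 = (r + s) mod 6" using i(1) by simp
qed

lemma nth_cubic_monomial:
  assumes "supported_mod_6 r f" "supported_mod_6 s g" "supported_mod_6 t h"
    and "(r + s + t) mod 6 \<noteq> m mod 6"
  shows "fps_nth (f * g * h) m = 0"
  using supported_mod_6_mult[OF supported_mod_6_mult[OF assms(1,2)] assms(3)] assms(4)
  unfolding supported_mod_6_def by metis

lemma eis_norm_mod:
  assumes "z \<in> class_mod_2theta i a b"
  shows "3 dvd int (eis_norm z) - i\<^sup>2" "2 dvd int (eis_norm z) - (a\<^sup>2 - a * b + b\<^sup>2)"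
proof -
  obtain x y where z: "z = (x, y)" by (cases z)
  have "3 dvd x + y - i" "2 dvd x - a" "2 dvd y - b"
    using assms by (simp_all add: z mem_class_mod_2theta)
  then obtain k l m where k: "x + y - i = 3 * k" and l: "x - a = 2 * l" and m: "y - b = 2 * m"
    unfolding dvd_def by blast
  have i: "i = x + y - 3 * k" and x: "x = a + 2 * l" and y: "y = b + 2 * m" using k l m by simp_all
  have "int (eis_norm z) - i\<^sup>2 = 3 * (2 * k * (x + y) - 3 * k\<^sup>2 - x * y)"
    unfolding z i int_eis_norm by (simp add: power2_eq_square algebra_simps)
  then show "3 dvd int (eis_norm z) - i\<^sup>2" by simp
  have "int (eis_norm z) - (a\<^sup>2 - a * b + b\<^sup>2) =
      2 * (2 * a * l + 2 * l\<^sup>2 - a * m - b * l - 2 * l * m + 2 * b * m + 2 * m\<^sup>2)"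
    unfolding z x y int_eis_norm by (simp add: power2_eq_square algebra_simps)
  then show "2 dvd int (eis_norm z) - (a\<^sup>2 - a * b + b\<^sup>2)" by simp
qed

lemma supported_theta:
  "supported_mod_6 0 (even_theta 0)" "supported_mod_6 4 (even_theta 1)"
  "supported_mod_6 3 (odd_theta 0)" "supported_mod_6 1 (odd_theta 1)"
proof -
  have *: "3 dvd int n - i\<^sup>2 \<and> 2 dvd int n - (a\<^sup>2 - a * b + b\<^sup>2)"
    if nz: "fps_nth (gf eis_norm (class_mod_2theta i a b)) n \<noteq> 0" for i a b n
  proof -
    obtain z where "z \<in> class_mod_2theta i a b" "eis_norm z = n"
      using nz unfolding gf_nth by (metis (mono_tags, lifting) card.empty empty_Collect_eq of_nat_0)
    then show ?thesis using eis_norm_mod by blast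
  qed
  have "n mod 6 = 0" if "fps_nth (even_theta 0) n \<noteq> 0" for n using *[OF that] by simp presburger
  moreover have "n mod 6 = 4" if "fps_nth (even_theta 1) n \<noteq> 0" for n using *[OF that] by simp presburger
  moreover have "n mod 6 = 3" if "fps_nth (odd_theta 0) n \<noteq> 0" for n using *[OF that] by simp presburger
  moreover have "n mod 6 = 1" if "fps_nth (odd_theta 1) n \<noteq> 0" for n using *[OF that] by simp presburger
  ultimately show "supported_mod_6 0 (even_theta 0)" "supported_mod_6 4 (even_theta 1)"
    "supported_mod_6 3 (odd_theta 0)" "supported_mod_6 1 (odd_theta 1)"
    by (simp_all add: supported_mod_6_def)
qed

text \<open>The difference \<open>D\<close> of the two sides reproduces itself under \<open>q \<mapsto> q\<^sup>2\<close> up to factors of order at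
  least 1, and comparing lowest degrees leaves only \<open>D = 0\<close>.\<close>

lemma cubic_relation:
  shows "3 * odd_theta 0 * odd_theta 1 * odd_theta 1 = odd_theta 0 * even_theta 1 * even_theta 1 + 2 * odd_theta 1 * even_theta 0 * even_theta 1"
proof (rule ccontr)
  define F0 F1 G0 G1 where defs: "F0 = even_theta 0" "F1 = even_theta 1"
    "G0 = odd_theta 0" "G1 = odd_theta 1"
  define D where "D = 3 * G0 * G1 * G1 - G0 * F1 * F1 - 2 * G1 * F0 * F1"
  assume "\<not> ?thesis"
  then have "D \<noteq> 0" by (simp add: D_def defs algebra_simps)
  have comp: "(f * g) oo fps_X ^ 2 = (f oo fps_X ^ 2) * (g oo fps_X ^ 2)"
    "(f + g) oo fps_X ^ 2 = (f oo fps_X ^ 2) + (g oo fps_X ^ 2)"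
    "(f - g) oo fps_X ^ 2 = (f oo fps_X ^ 2) - (g oo fps_X ^ 2)"
    "2 oo fps_X ^ 2 = (2 :: int fps)" "3 oo fps_X ^ 2 = (3 :: int fps)" for f g :: "int fps"
    by (simp_all add: fps_compose_mult_distrib fps_compose_add_distrib fps_compose_sub_distrib)
  note formulas = product_formulas[folded defs, unfolded comp]
  have "G1 * D = 3 * (G0 * G1) * (G1 * G1) - (G0 * G1) * (F1 * F1)
      - 2 * (G1 * G1) * (F0 * F1)"
    by (simp add: D_def algebra_simps)
  also have "\<dots> = (2 * (F1 - G1) * D) oo fps_X ^ 2"
    unfolding D_def comp formulas by algebra
  finally have self: "G1 * D = (2 * (F1 - G1) * D) oo fps_X ^ 2" .
  have "(1, 0) \<in> {z \<in> class_mod_2theta 1 1 0. eis_norm z = 1}"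
    by (simp add: class_mod_2theta_def eis_norm_def)
  then have "card {z \<in> class_mod_2theta 1 1 0. eis_norm z = 1} \<noteq> 0"
    using finite_levelsD[OF finite_levels_eis_norm] by (metis card_0_eq empty_iff)
  then have G1: "fps_nth (G1) 0 = 0" "fps_nth (G1) 1 \<noteq> 0"
    using supported_theta(4) by (auto simp: defs gf_nth supported_mod_6_def)
  have F1: "fps_nth (F1) 0 = 0"
    using supported_theta(2) by (auto simp: defs supported_mod_6_def)
  \<comment> \<open>As \<open>F1 - G1\<close> has no constant term, \<open>2 * (F1 - G1) * D\<close> vanishes up to degree \<open>d\<close>. After the
    substitution of \<open>q\<^sup>2\<close>, its coefficient at \<open>d + 1\<close> is 0 or the old one at \<open>(d + 1) / 2 \<le> d\<close>.\<close>
  define d where "d = subdegree D"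
  have "fps_nth (2 * (F1 - G1) * D) k = 0" if "k \<le> d" for k
  proof -
    have "fps_nth (2 * (F1 - G1)) i * fps_nth D (k - i) = 0" if "i \<le> k" for i
    proof (cases "i = 0")
      case False
      then have "k - i < subdegree D" using that \<open>k \<le> d\<close> by (auto simp: d_def)
      then show ?thesis by (simp add: nth_less_subdegree_zero)
    qed (simp add: G1 F1)
    then show ?thesis unfolding fps_mult_nth[of "2 * (F1 - G1)" D] by (intro sum.neutral) auto
  qed
  then have "fps_nth (G1 * D) (d + 1) = 0"
    unfolding self fps_nth_compose_X_power by (cases "d = 0") auto
  moreover have "subdegree (G1) = 1"
    by (rule subdegreeI) (use G1 in auto)
  then have "subdegree (G1 * D) = d + 1"
    using \<open>D \<noteq> 0\<close> G1 by (subst subdegree_mult) (auto simp: d_def)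
  ultimately have "G1 * D = 0" by (metis nth_subdegree_zero_iff)
  then show False using \<open>D \<noteq> 0\<close> G1 by auto
qed

section \<open>Representations by the six-variable form\<close>

lemma gf_theta_class: "gf eis_norm (theta_class i) = even_theta i + 3 * odd_theta i"
proof -
  have split: "theta_class i = (\<Union>(a, b)\<in>{0, 1} \<times> {0, 1}. class_mod_2theta i a b)"
    by (auto simp: theta_class_def class_mod_2theta_def)
  have "gf eis_norm (theta_class i) = (\<Sum>(a, b)\<in>{0, 1} \<times> {0, 1}. gf eis_norm (class_mod_2theta i a b))"
    unfolding split by (subst gf_UN) (auto simp: finite_levels_eis_norm class_mod_2theta_def)
  then show ?thesis by (simp add: gf_odd_classes)
qed

text \<open>The subring \<open>\<int>[\<theta>]\<close>: since \<open>\<theta> = 1 + 2 w\<close>, the element \<open>x + y \<theta>\<close> is the pair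
  \<open>(x + y, 2 y)\<close>, and its norm is \<open>x\<^sup>2 + 3 y\<^sup>2\<close>.\<close>

definition sqrt3_order :: "(int \<times> int) set" where
  "sqrt3_order = {z. 2 dvd snd z}"

lemma gf_sqrt3_order:
  "gf eis_norm sqrt3_order = even_theta 0 + 2 * even_theta 1 + odd_theta 0 + 2 * odd_theta 1"
proof -
  have split: "sqrt3_order = (\<Union>(i, a)\<in>{0, 1, 2} \<times> {0, 1}. class_mod_2theta i a 0)"
    by (auto simp: sqrt3_order_def class_mod_2theta_def) presburger+
  have "gf eis_norm sqrt3_order = (\<Sum>(i, a)\<in>{0, 1, 2} \<times> {0, 1}. gf eis_norm (class_mod_2theta i a 0))"
    unfolding split
    by (subst gf_UN) (auto simp: finite_levels_eis_norm class_mod_2theta_def, presburger+)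
  then show ?thesis by (simp add: classes_2)
qed

lemma omega_eq_nth: "int (omega n) = fps_nth (gf eis_norm sqrt3_order ^ 3) n"
proof -
  let ?w = "eis_norm \<oplus>w eis_norm \<oplus>w eis_norm"
  let ?S = "sqrt3_order \<times> sqrt3_order \<times> sqrt3_order"
  let ?A = "{(x1 :: int, x2 :: int, x3 :: int, y1 :: int, y2 :: int, y3 :: int).
     x1\<^sup>2 + x2\<^sup>2 + x3\<^sup>2 + 3 * y1\<^sup>2 + 3 * y2\<^sup>2 + 3 * y3\<^sup>2 = int n}"
  let ?f = "\<lambda>(x1, x2, x3, y1, y2, y3). ((x1 + y1, 2 * y1), (x2 + y2, 2 * y2), (x3 + y3, 2 * y3))
    :: (int \<times> int) \<times> (int \<times> int) \<times> (int \<times> int)"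
  let ?g = "\<lambda>((x1, y1), (x2, y2), (x3, y3)).
    (x1 - y1 div 2, x2 - y2 div 2, x3 - y3 div 2, y1 div 2, y2 div 2, y3 div 2)
    :: int \<times> int \<times> int \<times> int \<times> int \<times> int"
  have norm: "int (eis_norm (x + y, 2 * y)) = x\<^sup>2 + 3 * y\<^sup>2" for x y :: int
    by (simp add: int_eis_norm power2_eq_square algebra_simps)
  have weight: "int (?w (?f (x1, x2, x3, y1, y2, y3))) =
      x1\<^sup>2 + x2\<^sup>2 + x3\<^sup>2 + 3 * y1\<^sup>2 + 3 * y2\<^sup>2 + 3 * y3\<^sup>2" for x1 x2 x3 y1 y2 y3
    by (simp add: norm)
  have "bij_betw ?f ?A {z \<in> ?S. ?w z = n}"
  proof (rule bij_betw_byWitness[where f' = ?g])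
    show "\<forall>z\<in>{z \<in> ?S. ?w z = n}. ?f (?g z) = z" by (auto simp: sqrt3_order_def)
    show "?f ` ?A \<subseteq> {z \<in> ?S. ?w z = n}"
    proof (rule image_subsetI)
      fix z assume z: "z \<in> ?A"
      obtain x1 x2 x3 y1 y2 y3 where e: "z = (x1, x2, x3, y1, y2, y3)" by (metis surj_pair)
      have "int (?w (?f z)) = int n" using z weight[of x1 x2 x3 y1 y2 y3] unfolding e by simp
      then show "?f z \<in> {z \<in> ?S. ?w z = n}" by (simp add: e sqrt3_order_def)
    qed
    show "?g ` {z \<in> ?S. ?w z = n} \<subseteq> ?A"
    proof (rule image_subsetI)
      fix z assume z: "z \<in> {z \<in> ?S. ?w z = n}"
      obtain x1 y1 x2 y2 x3 y3 where e: "z = ((x1, y1), (x2, y2), (x3, y3))" by (metis surj_pair)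
      obtain k1 k2 k3 where k: "y1 = 2 * k1" "y2 = 2 * k2" "y3 = 2 * k3"
        using z by (auto simp: e sqrt3_order_def elim!: dvdE)
      have "?f (?g z) = z" by (simp add: e k)
      then have "int (?w (?f (?g z))) = int n" using z by simp
      then show "?g z \<in> ?A" using weight[of "x1 - k1" "x2 - k2" "x3 - k3" k1 k2 k3]
        unfolding e k by simp
    qed
  qed auto
  then have "omega n = card {z \<in> ?S. ?w z = n}"
    unfolding omega_def by (rule bij_betw_same_card)
  then have "int (omega n) = fps_nth (gf ?w ?S) n" by (simp add: gf_nth)
  then show ?thesis
    by (simp only: gf_product3 finite_levels_eis_norm power3_eq_cube)
qed

lemma omega_eq:
  assumes "m mod 6 = 5"
  shows "int (omega m) = 48 * fps_nth (odd_theta 0 * odd_theta 1 * odd_theta 1) m"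
proof -
  let ?A = "even_theta 0" and ?B = "even_theta 1" and ?C = "odd_theta 0" and ?D = "odd_theta 1"
  have vanish: "fps_nth (?A * ?A * ?A) m = 0" "fps_nth (?B * ?B * ?B) m = 0"
    "fps_nth (?C * ?C * ?C) m = 0" "fps_nth (?D * ?D * ?D) m = 0"
    "fps_nth (?A * ?A * ?B) m = 0" "fps_nth (?A * ?A * ?C) m = 0" "fps_nth (?A * ?A * ?D) m = 0"
    "fps_nth (?B * ?B * ?A) m = 0" "fps_nth (?B * ?B * ?D) m = 0"
    "fps_nth (?C * ?C * ?A) m = 0" "fps_nth (?C * ?C * ?B) m = 0" "fps_nth (?C * ?C * ?D) m = 0"
    "fps_nth (?D * ?D * ?A) m = 0" "fps_nth (?D * ?D * ?B) m = 0"
    "fps_nth (?A * ?B * ?C) m = 0" "fps_nth (?A * ?C * ?D) m = 0" "fps_nth (?B * ?C * ?D) m = 0"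
    by (rule nth_cubic_monomial, (rule supported_theta)+, simp add: assms)+
  have "(?A + 2 * ?B + ?C + 2 * ?D) ^ 3 =
      ?A * ?A * ?A + 8 * (?B * ?B * ?B) + ?C * ?C * ?C + 8 * (?D * ?D * ?D)
      + 6 * (?A * ?A * ?B) + 3 * (?A * ?A * ?C) + 6 * (?A * ?A * ?D)
      + 12 * (?B * ?B * ?A) + 24 * (?B * ?B * ?D)
      + 3 * (?C * ?C * ?A) + 6 * (?C * ?C * ?B) + 6 * (?C * ?C * ?D)
      + 12 * (?D * ?D * ?A) + 24 * (?D * ?D * ?B)
      + 12 * (?A * ?B * ?C) + 12 * (?A * ?C * ?D) + 24 * (?B * ?C * ?D)
      + (12 * (?C * ?B * ?B + 2 * ?D * ?A * ?B) + 12 * (?C * ?D * ?D))"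
    by algebra
  also have "12 * (?C * ?B * ?B + 2 * ?D * ?A * ?B) + 12 * (?C * ?D * ?D) = 48 * (?C * ?D * ?D)"
    unfolding cubic_relation[symmetric] by algebra
  finally show ?thesis
    unfolding omega_eq_nth gf_sqrt3_order
    by (simp add: numeral_fps_const vanish)
qed

section \<open>Triples of three-cores\<close>

definition one_mod_three :: "(int \<times> int) set" where
  "one_mod_three = {z. 3 dvd fst z - 1 \<and> 3 dvd snd z}"

text \<open>As \<open>w - 1\<close> is a unit times \<open>\<theta>\<close>, multiplication by \<open>w\<close> permutes cyclically the three classes
  modulo 3 that lie in one nonzero class modulo \<open>\<theta>\<close>.\<close>

lemma gf_one_mod_three: "gf eis_norm (theta_class 1) = 3 * gf eis_norm one_mod_three"
proof -
  have "gf eis_norm (theta_class 1) =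
      3 * gf eis_norm {z \<in> theta_class 1. 3 dvd fst z - 1 \<and> 3 dvd snd z}"
  proof (rule gf_threefold[where f = rot])
    fix z :: "int \<times> int"
    obtain x y where z: "z = (x, y)" by (cases z)
    assume "z \<in> theta_class 1"
    then have d: "3 dvd x + y - 1" by (simp add: z mem_theta_class)
    show "rot z \<in> theta_class 1" using d unfolding z rot_def theta_class_def by simp presburger
    let ?P = "\<lambda>z. 3 dvd fst z - 1 \<and> 3 dvd snd z"
    show "?P z \<or> ?P (rot z) \<or> ?P (rot (rot z))"
      using d unfolding z rot_def by simp presburger
    assume "?P z"
    then show "\<not> ?P (rot z)" using d unfolding z rot_def by simp presburger
  qed (simp_all add: finite_levels_eis_norm eis_norm_rot rot_rot_rot)
  moreover have "{z \<in> theta_class 1. 3 dvd fst z - 1 \<and> 3 dvd snd z} = one_mod_three"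
    by (auto simp: theta_class_def one_mod_three_def) presburger
  ultimately show ?thesis by simp
qed

text \<open>The open sector of angle \<open>2\<pi>/3\<close> between the rays of \<open>-\<theta>\<close> and \<open>2 + w = -w \<theta>\<close>. All
  elements on these two lines are multiples of \<open>\<theta>\<close>, so the three rotations of the sector cover the
  class of 1 modulo \<open>\<theta>\<close> without overlap.\<close>

definition sector :: "(int \<times> int) set" where
  "sector = {z \<in> theta_class 1. fst z > 2 * snd z \<and> 2 * fst z > snd z}"

lemma gf_sector: "gf eis_norm (theta_class 1) = 3 * gf eis_norm sector"
  unfolding sector_def
proof (rule gf_threefold[where f = rot])
  fix z :: "int \<times> int"
  obtain x y where z: "z = (x, y)" by (cases z)
  assume "z \<in> theta_class 1"
  then have d: "3 dvd x + y - 1" by (simp add: z mem_theta_class)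
  then have nz: "x + y \<noteq> 0" "x \<noteq> 2 * y" "2 * x \<noteq> y" by presburger+
  show "rot z \<in> theta_class 1" using d unfolding z rot_def theta_class_def by simp presburger
  let ?P = "\<lambda>z. fst z > 2 * snd z \<and> 2 * fst z > snd z"
  show "?P z \<or> ?P (rot z) \<or> ?P (rot (rot z))"
    using nz unfolding z rot_def by simp linarith
  assume "?P z"
  then show "\<not> ?P (rot z)" using nz unfolding z rot_def by simp
qed (simp_all add: finite_levels_eis_norm eis_norm_rot rot_rot_rot)

text \<open>The element \<open>1 - \<theta> (r + s w)\<close>. Its norm \<open>3 (r\<^sup>2 - r s + s\<^sup>2 + s) + 1\<close> is three times the size of the
  core with \<open>r\<close> and \<open>s\<close> beads on its two runners, plus 1.\<close>

definition sector_point :: "nat \<times> nat \<Rightarrow> int \<times> int" where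
  "sector_point rs = (1 - int (fst rs) + 2 * int (snd rs), int (snd rs) - 2 * int (fst rs))"

lemma bij_betw_sector_point: "bij_betw sector_point UNIV sector"
proof (rule bij_betw_byWitness
    [where f' = "\<lambda>z. (nat ((fst z - 1 - 2 * snd z) div 3), nat ((2 * fst z - 2 - snd z) div 3))"])
  show "sector_point ` UNIV \<subseteq> sector"
    by (auto simp: sector_point_def sector_def theta_class_def)
  show "\<forall>z\<in>sector. sector_point (nat ((fst z - 1 - 2 * snd z) div 3),
      nat ((2 * fst z - 2 - snd z) div 3)) = z"
  proof
    fix z assume z: "z \<in> sector"
    obtain x y where e: "z = (x, y)" by (cases z)
    have "3 dvd x + y - 1" "x > 2 * y" "2 * x > y"
      using z by (simp_all add: e sector_def theta_class_def)
    then have "x - 1 - 2 * y = 3 * ((x - 1 - 2 * y) div 3)" "2 * x - 2 - y = 3 * ((2 * x - 2 - y) div 3)"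
       "(x - 1 - 2 * y) div 3 \<ge> 0" "(2 * x - 2 - y) div 3 \<ge> 0" by presburger+
    then show "sector_point (nat ((fst z - 1 - 2 * snd z) div 3),
        nat ((2 * fst z - 2 - snd z) div 3)) = z"
      by (simp add: e sector_point_def)
  qed
qed (auto simp: sector_point_def)

lemma gf_cores: "gf (\<lambda>p. 3 * sum_list p + 1) {p. is_core 3 p} = gf eis_norm one_mod_three"
  and finite_levels_cores: "finite_levels (\<lambda>p. 3 * sum_list p + 1) {p. is_core 3 p}"
proof -
  let ?v = "\<lambda>p :: nat list. 3 * sum_list p + 1"
  have w: "eis_norm (sector_point rs) = ?v (core_of rs)" for rs
  proof -
    obtain r s where rs: "rs = (r, s)" by (cases rs)
    have "int (eis_norm (sector_point rs)) = int (?v (core_of rs))"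
      using sum_list_core_of[of r s]
      by (simp add: rs sector_point_def int_eis_norm power2_eq_square algebra_simps)
    then show ?thesis by linarith
  qed
  have inv: "bij_betw (inv core_of) {p. is_core 3 p} UNIV"
    using bij_betw_inv_into[OF bij_betw_core_of] .
  have b: "bij_betw (sector_point \<circ> inv core_of) {p. is_core 3 p} sector"
    by (rule bij_betw_trans[OF inv bij_betw_sector_point])
  have wb: "eis_norm ((sector_point \<circ> inv core_of) p) = ?v p" if "p \<in> {p. is_core 3 p}" for p
    using w[of "inv core_of p"] that bij_betw_core_of by (simp add: bij_betw_def f_inv_into_f)
  show "finite_levels ?v {p. is_core 3 p}"
    by (rule finite_levels_bij[OF b _ finite_levels_eis_norm]) (rule wb)
  have "gf ?v {p. is_core 3 p} = gf eis_norm sector"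
    by (rule gf_bij[OF b]) (rule wb)
  moreover have "3 * gf eis_norm sector = 3 * gf eis_norm one_mod_three"
    using gf_sector gf_one_mod_three by simp
  ultimately show "gf ?v {p. is_core 3 p} = gf eis_norm one_mod_three" by simp
qed

lemma B3_eq_nth: "int (B3 n) = fps_nth (gf eis_norm one_mod_three ^ 3) (3 * n + 3)"
proof -
  let ?v = "\<lambda>p :: nat list. 3 * sum_list p + 1" and ?C = "{p. is_core 3 p}"
  have "{(p1, p2, p3). is_core 3 p1 \<and> is_core 3 p2 \<and> is_core 3 p3 \<and>
     sum_list p1 + sum_list p2 + sum_list p3 = n} =
    {z \<in> ?C \<times> ?C \<times> ?C. (?v \<oplus>w ?v \<oplus>w ?v) z = 3 * n + 3}"
    by auto
  then have "int (B3 n) = fps_nth (gf (?v \<oplus>w ?v \<oplus>w ?v) (?C \<times> ?C \<times> ?C)) (3 * n + 3)"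
    unfolding B3_def gf_nth by (simp only:)
  then show ?thesis
    by (simp only: gf_product3[OF finite_levels_cores finite_levels_cores finite_levels_cores]
        gf_cores power3_eq_cube)
qed

text \<open>The discrete Fourier transform \<open>(a, b, c) \<mapsto> (a + b + c, a + w\<^sup>2 b + w c, a + w b + w\<^sup>2 c)\<close>. It
  multiplies norms by 3, and its inverse is the conjugate transform divided by 3, which is
  integral on vectors whose entries are all 1 modulo 3.\<close>

definition dft :: "(int \<times> int) \<times> (int \<times> int) \<times> (int \<times> int) \<Rightarrow> (int \<times> int) \<times> (int \<times> int) \<times> (int \<times> int)"
  where "dft = (\<lambda>((x, y), (u, v), (p, q)).
    ((x + u + p, y + v + q),
     (x + (v - u) - q, y - u + (p - q)),
     (x - v + (q - p), y + (u - v) - p)))"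

lemma gf_dft:
  fixes w :: "(int \<times> int) \<times> (int \<times> int) \<times> (int \<times> int) \<Rightarrow> nat"
  defines "w \<equiv> eis_norm \<oplus>w eis_norm \<oplus>w eis_norm"
  shows "gf w (one_mod_three \<times> one_mod_three \<times> one_mod_three) =
    gf w (dft -` (one_mod_three \<times> one_mod_three \<times> one_mod_three)) oo fps_X ^ 3"
proof -
  let ?C = "one_mod_three \<times> one_mod_three \<times> one_mod_three"
  let ?g = "\<lambda>((x, y), (u, v), (p, q)).
    (((x + u + p) div 3, (y + v + q) div 3),
     ((x - v + (q - p)) div 3, (y + (u - v) - p) div 3),
     ((x + (v - u) - q) div 3, (y - u + (p - q)) div 3))
    :: (int \<times> int) \<times> (int \<times> int) \<times> (int \<times> int)"
  have inv: "dft (?g z) = z" if "z \<in> ?C" for z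
  proof -
    obtain x y u v p q where z: "z = ((x, y), (u, v), (p, q))" by (metis surj_pair)
    have "3 dvd x - 1" "3 dvd y" "3 dvd u - 1" "3 dvd v" "3 dvd p - 1" "3 dvd q"
      using that by (simp_all add: z one_mod_three_def)
    then obtain a b c d e f where "x - 1 = 3 * a" "y = 3 * b" "u - 1 = 3 * c" "v = 3 * d"
      "p - 1 = 3 * e" "q = 3 * f" by (metis dvdE)
    then have *: "x = 1 + 3 * a" "y = 3 * b" "u = 1 + 3 * c" "v = 3 * d" "p = 1 + 3 * e" "q = 3 * f"
      by simp_all
    have "(x + u + p) div 3 = 1 + a + c + e" "(y + v + q) div 3 = b + d + f"
      "(x - v + (q - p)) div 3 = a - d + f - e" "(y + (u - v) - p) div 3 = b + c - d - e"
      "(x + (v - u) - q) div 3 = a + d - c - f" "(y - u + (p - q)) div 3 = b - c + e - f"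
      unfolding * by presburger+
    then show ?thesis by (simp add: z dft_def *)
  qed
  have inv': "?g (dft z) = z" for z
  proof -
    obtain x y u v p q where z: "z = ((x, y), (u, v), (p, q))" by (metis surj_pair)
    show ?thesis by (simp add: z dft_def)
  qed
  have "bij_betw dft (dft -` ?C) ?C"
    by (rule bij_betw_byWitness[where f' = ?g]) (use inv inv' in auto)
  then have "gf (\<lambda>z. 3 * w z) (dft -` ?C) = gf w ?C"
  proof (rule gf_bij)
    fix z :: "(int \<times> int) \<times> (int \<times> int) \<times> (int \<times> int)"
    obtain x y u v p q where z: "z = ((x, y), (u, v), (p, q))" by (metis surj_pair)
    have "int (w (dft z)) = int (3 * w z)"
      by (simp add: z w_def dft_def int_eis_norm power2_eq_square algebra_simps)
    then show "w (dft z) = 3 * w z" by linarith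
  qed
  then show ?thesis by (simp add: gf_scale)
qed

text \<open>If the transform of \<open>(a, b, c)\<close> has entries that are 1 modulo 3, then modulo \<open>\<theta>\<close> its entries
  have the form \<open>(t + 1, t, t)\<close>, and its norm is \<open>2 t + 1\<close> modulo 3. A norm that is 2 modulo 3
  therefore forces \<open>t = 2\<close>.\<close>

lemma dft_in_one_mod_three_iff:
  fixes z :: "(int \<times> int) \<times> (int \<times> int) \<times> (int \<times> int)"
  defines "w \<equiv> eis_norm \<oplus>w eis_norm \<oplus>w eis_norm"
  assumes "w z mod 3 = 2"
  shows "dft z \<in> one_mod_three \<times> one_mod_three \<times> one_mod_three \<longleftrightarrow>
    z \<in> theta_class 0 \<times> theta_class 2 \<times> theta_class 2 \<and> fst (dft z) \<in> one_mod_three"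
proof -
  obtain x y u v p q where z: "z = ((x, y), (u, v), (p, q))" by (metis surj_pair)
  have sq: "\<exists>k. int (eis_norm (a, b)) = (a + b)\<^sup>2 - 3 * k" for a b
    by (rule exI[of _ "a * b"]) (simp add: int_eis_norm power2_eq_square algebra_simps)
  obtain k l m where "int (eis_norm (x, y)) = (x + y)\<^sup>2 - 3 * k"
    "int (eis_norm (u, v)) = (u + v)\<^sup>2 - 3 * l" "int (eis_norm (p, q)) = (p + q)\<^sup>2 - 3 * m"
    using sq by metis
  then have "int (w z) = (x + y)\<^sup>2 + (u + v)\<^sup>2 + (p + q)\<^sup>2 - 3 * (k + l + m)"
    by (simp add: z w_def)
  moreover have "\<exists>n. int (w z) = 3 * n + 2" using assms(2) by presburger
  then obtain n where "int (w z) = 3 * n + 2" ..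
  ultimately have "(x + y)\<^sup>2 + (u + v)\<^sup>2 + (p + q)\<^sup>2 = 3 * (n + k + l + m) + 2" by simp
  then have norm: "\<exists>n. (x + y)\<^sup>2 + (u + v)\<^sup>2 + (p + q)\<^sup>2 = 3 * n + 2" ..
  have lhs: "dft z \<in> one_mod_three \<times> one_mod_three \<times> one_mod_three \<longleftrightarrow>
    3 dvd x + u + p - 1 \<and> 3 dvd y + v + q \<and>
    3 dvd x + (v - u) - q - 1 \<and> 3 dvd y - u + (p - q) \<and>
    3 dvd x - v + (q - p) - 1 \<and> 3 dvd y + (u - v) - p"
    by (simp add: z dft_def one_mod_three_def)
  have rhs: "z \<in> theta_class 0 \<times> theta_class 2 \<times> theta_class 2 \<and> fst (dft z) \<in> one_mod_three \<longleftrightarrow>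
    3 dvd x + y \<and> 3 dvd u + v - 2 \<and> 3 dvd p + q - 2 \<and> 3 dvd x + u + p - 1 \<and> 3 dvd y + v + q"
    by (simp add: z dft_def one_mod_three_def theta_class_def)
  show ?thesis unfolding lhs rhs
  proof
    assume l: "3 dvd x + u + p - 1 \<and> 3 dvd y + v + q \<and>
      3 dvd x + (v - u) - q - 1 \<and> 3 dvd y - u + (p - q) \<and>
      3 dvd x - v + (q - p) - 1 \<and> 3 dvd y + (u - v) - p"
    then have "3 dvd (x + y) - (u + v) - 1" "3 dvd (u + v) - (p + q)" by presburger+
    then obtain i j where ij: "(x + y) - (u + v) - 1 = 3 * i" "(u + v) - (p + q) = 3 * j"
      unfolding dvd_def by blast
    define t where "t = p + q"
    have t: "u + v = t + 3 * j" "x + y = t + 3 * j + 1 + 3 * i" using ij by (simp_all add: t_def)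
    obtain n where n: "(x + y)\<^sup>2 + (u + v)\<^sup>2 + (p + q)\<^sup>2 = 3 * n + 2" using norm by blast
    have "(x + y)\<^sup>2 + (u + v)\<^sup>2 + (p + q)\<^sup>2 = 2 * t + 1 +
        3 * (t\<^sup>2 + 2 * t * j + 3 * j\<^sup>2 + 2 * (t + 1) * (i + j) + 3 * (i + j)\<^sup>2)"
      unfolding t t_def[symmetric] by (simp add: power2_eq_square algebra_simps)
    then have "3 dvd t - 2" using n by presburger
    then obtain e where e: "t = 3 * e + 2" unfolding dvd_def by (metis diff_eq_eq)
    have "x + y = 3 * (e + i + j + 1)" "u + v - 2 = 3 * (e + j)" "p + q - 2 = 3 * e"
      using t e t_def by - presburger+
    then show "3 dvd x + y \<and> 3 dvd u + v - 2 \<and> 3 dvd p + q - 2 \<and>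
        3 dvd x + u + p - 1 \<and> 3 dvd y + v + q"
      using l by (metis dvd_triv_left)
  next
    assume "3 dvd x + y \<and> 3 dvd u + v - 2 \<and> 3 dvd p + q - 2 \<and>
        3 dvd x + u + p - 1 \<and> 3 dvd y + v + q"
    then obtain a b c d where abcd: "u + v - 2 = 3 * a" "p + q - 2 = 3 * b"
      "x + u + p - 1 = 3 * c" "y + v + q = 3 * d"
      unfolding dvd_def by blast
    have "x + (v - u) - q - 1 = 3 * (c + a - b - u)" "y - u + (p - q) = 3 * (d - a + b - q)"
      "x - v + (q - p) - 1 = 3 * (c - a + b - p)" "y + (u - v) - p = 3 * (d - b + a - v)"
      using abcd by - (simp add: algebra_simps)+
    with abcd show "3 dvd x + u + p - 1 \<and> 3 dvd y + v + q \<and>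
      3 dvd x + (v - u) - q - 1 \<and> 3 dvd y - u + (p - q) \<and>
      3 dvd x - v + (q - p) - 1 \<and> 3 dvd y + (u - v) - p"
      by (metis dvd_triv_left)
  qed
qed

lemma B3_eq:
  assumes "m mod 6 = 5"
  shows "int (B3 (m - 1)) = 12 * fps_nth (odd_theta 0 * odd_theta 1 * odd_theta 1) m"
proof -
  let ?A = "even_theta 0" and ?B = "even_theta 1" and ?C = "odd_theta 0" and ?D = "odd_theta 1"
  let ?w = "eis_norm \<oplus>w eis_norm \<oplus>w eis_norm"
  let ?T = "one_mod_three \<times> one_mod_three \<times> one_mod_three"
  let ?S = "theta_class 0 \<times> theta_class 2 \<times> theta_class 2"
  let ?P = "\<lambda>z. fst (dft z) \<in> one_mod_three"
  have "m > 0" using assms by (cases m) auto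
  have m3: "m mod 3 = 2" using assms by presburger
  have "int (B3 (m - 1)) = fps_nth (gf ?w ?T) (3 * m)"
    using B3_eq_nth[of "m - 1"] \<open>m > 0\<close>
    by (simp add: gf_product3[OF finite_levels_eis_norm finite_levels_eis_norm finite_levels_eis_norm]
        power3_eq_cube algebra_simps)
  also have "\<dots> = fps_nth (gf ?w (dft -` ?T)) m"
    by (simp add: gf_dft fps_nth_compose_X_power)
  also have "\<dots> = fps_nth (gf ?w {z \<in> ?S. ?P z}) m"
  proof -
    have "z \<in> dft -` ?T \<and> ?w z = m \<longleftrightarrow> z \<in> {z \<in> ?S. ?P z} \<and> ?w z = m" for z
    proof (cases "?w z = m")
      case True
      then have "?w z mod 3 = 2" using m3 by simp
      from dft_in_one_mod_three_iff[OF this] True show ?thesis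
        by (simp only: vimage_eq mem_Collect_eq simp_thms)
    qed (simp only: simp_thms)
    then show ?thesis by (simp only: gf_nth)
  qed
  finally have B3: "int (B3 (m - 1)) = fps_nth (gf ?w {z \<in> ?S. ?P z}) m" .
  \<comment> \<open>Rotating the second entry shifts the first entry of the transform by a unit times \<open>\<theta>\<close>
    modulo 3, so it runs through the three classes modulo 3 that are 1 modulo \<open>\<theta>\<close>.\<close>
  have "gf ?w ?S = 3 * gf ?w {z \<in> ?S. ?P z}"
  proof (rule gf_threefold[where f = "\<lambda>(a, b, c). (a, rot b, c)"])
    fix z assume S: "z \<in> ?S"
    obtain x y u v p q where z: "z = ((x, y), (u, v), (p, q))" by (metis surj_pair)
    have d: "3 dvd x + y" "3 dvd u + v - 2" "3 dvd p + q - 2"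
      using S by (simp_all add: z theta_class_def)
    let ?f = "\<lambda>(a, b, c). (a, rot b, c)"
    show "?f z \<in> ?S" using d by (simp add: z rot_def theta_class_def) presburger
    show "?w (?f z) = ?w z" by (simp add: z eis_norm_rot)
    show "?f (?f (?f z)) = z" by (simp add: z rot_rot_rot)
    have P: "?P z \<longleftrightarrow> 3 dvd x + u + p - 1 \<and> 3 dvd y + v + q"
      "?P (?f z) \<longleftrightarrow> 3 dvd x - v + p - 1 \<and> 3 dvd y + (u - v) + q"
      "?P (?f (?f z)) \<longleftrightarrow> 3 dvd x + (v - u) + p - 1 \<and> 3 dvd y - u + q"
      by (simp_all add: z dft_def rot_def one_mod_three_def)
    show "?P z \<or> ?P (?f z) \<or> ?P (?f (?f z))" unfolding P using d by presburger
    show "\<not> ?P (?f z)" if "?P z" using that d unfolding P by presburger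
  qed (intro finite_levels_product finite_levels_eis_norm)
  moreover have "gf ?w ?S = (?A + 3 * ?C) * (?B + 3 * ?D) * (?B + 3 * ?D)"
    by (simp only: gf_product3 finite_levels_eis_norm gf_theta_class classes_2)
  ultimately have three: "3 * int (B3 (m - 1)) =
      fps_nth ((?A + 3 * ?C) * (?B + 3 * ?D) * (?B + 3 * ?D)) m"
    unfolding B3 by (simp add: numeral_fps_const)
  have vanish: "fps_nth (?A * ?B * ?B) m = 0" "fps_nth (?A * ?D * ?D) m = 0"
    "fps_nth (?B * ?C * ?D) m = 0"
    by (rule nth_cubic_monomial, (rule supported_theta)+, simp add: assms)+
  have "(?A + 3 * ?C) * (?B + 3 * ?D) * (?B + 3 * ?D) =
      ?A * ?B * ?B + 9 * (?A * ?D * ?D) + 18 * (?B * ?C * ?D)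
      + (3 * (?C * ?B * ?B + 2 * ?D * ?A * ?B) + 27 * (?C * ?D * ?D))"
    by algebra
  also have "3 * (?C * ?B * ?B + 2 * ?D * ?A * ?B) + 27 * (?C * ?D * ?D) = 36 * (?C * ?D * ?D)"
    unfolding cubic_relation[symmetric] by algebra
  finally have "3 * int (B3 (m - 1)) = 36 * fps_nth (?C * ?D * ?D) m"
    unfolding three by (simp add: numeral_fps_const vanish)
  then show ?thesis by simp
qed

theorem theorem2p6:
  fixes n :: nat
  shows "omega (6 * n + 5) = 4 * B3 (6 * n + 4)"
proof -
  have "int (omega (6 * n + 5)) = 4 * int (B3 (6 * n + 4))"
    using omega_eq[of "6 * n + 5"] B3_eq[of "6 * n + 5"] by (simp add: add.commute)
  then show ?thesis by linarith
qed

end
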